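(* Let $K$ be a commutative ring with $\mathbb Q\subset K$, let $\mathfrak g$ be a Lie $K$-algebra, and let $n\ge 1$. Suppose that the $K$-submodule $W\subset\bigotimes^n\mathfrak g$ is closed under the action of the symmetric group $\Sigma_n$ permuting the order of the tensor factors. Also assume that $\boldsymbol m|_W:W\to\mathcal U\mathfrak g$ is injective. If \[P=\sum_\lambda a_{1,\lambda}\otimes\cdots\otimes a_{n,\lambda}\] is such that $P\in W$ and $\boldsymbol m(P)\in\mathfrak g$, then \[n\cdot\boldsymbol m(P)=\sum_\lambda [a_{1,\lambda},\ldots,a_{n,\lambda}]_{\mathrm L}.\]
   Context: $\mathcal U\mathfrak g$ is the universal enveloping algebra of $\mathfrak g$, and $\boldsymbol m:\bigotimes\mathfrak g\to\mathcal U\mathfrak g$ is the canonical algebra homomorphism from the tensor algebra, $x_1\otimes\cdots\otimes x_n\mapsto x_1\cdots x_n$; $\bigotimes^n\mathfrak g$ is the $n$-fold tensor power over $K$. Since $\mathbb Q\subset K$, the (symmetric) Poincaré–Birkhoff–Witt theorem holds, so the canonical map $\mathfrak g\to\mathcal U\mathfrak g$ is injective and $\mathfrak g$ is regarded as a subset of $\mathcal U\mathfrak g$. Left-iterated commutators: $[Y_1,\ldots,Y_p]_{\mathrm L}=[Y_1,[Y_2,\ldots,[Y_{p-1},Y_p]\ldots]]$, with $[Y_1]_{\mathrm L}=Y_1$. *)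

theory Defs
  imports
    "HOL-Algebra.Algebra"
    "HOL-Algebra.Algebraic_Closure_Type"
    "HOL-Combinatorics.Permutations"
    "HOL-Library.Poly_Mapping"
begin

section \<open>Lie algebras over a commutative ring containing the rationals\<close>

definition contains_rat :: "'k::comm_ring_1 itself \<Rightarrow> bool" where
  "contains_rat _ \<longleftrightarrow> (\<exists>f :: rat \<Rightarrow> 'k. inj f \<and> f 1 = 1 \<and>
     (\<forall>x y. f (x + y) = f x + f y) \<and> (\<forall>x y. f (x * y) = f x * f y))"

locale lie_algebra = Modules.module scale
  for scale :: "'k::comm_ring_1 \<Rightarrow> 'g::ab_group_add \<Rightarrow> 'g" +
  fixes bracket :: "'g \<Rightarrow> 'g \<Rightarrow> 'g"
  assumes bracket_add_left: "bracket (x + y) z = bracket x z + bracket y z"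
    and bracket_add_right: "bracket x (y + z) = bracket x y + bracket x z"
    and bracket_scale_left: "bracket (scale c x) y = scale c (bracket x y)"
    and bracket_scale_right: "bracket x (scale c y) = scale c (bracket x y)"
    and bracket_self: "bracket x x = 0"
    and jacobi: "bracket x (bracket y z) + bracket y (bracket z x) + bracket z (bracket x y) = 0"

fun left_bracket :: "('g::zero \<Rightarrow> 'g \<Rightarrow> 'g) \<Rightarrow> 'g list \<Rightarrow> 'g" where
  "left_bracket br [] = 0"
| "left_bracket br [x] = x"
| "left_bracket br (x # y # ys) = br x (left_bracket br (y # ys))"

section \<open>The tensor algebra\<close>

text \<open>With concatenation as addition of words, \<open>'g list \<Rightarrow>\<^sub>0 'k\<close> is the free
  associative unital \<open>'k\<close>-algebra on the set \<open>'g\<close>; its multiplication is the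
  convolution product of the library.\<close>

instantiation list :: (type) monoid_add
begin
definition zero_list :: "'a list" where "zero_list = []"
definition plus_list :: "'a list \<Rightarrow> 'a list \<Rightarrow> 'a list" where "plus_list = (@)"
instance by standard (auto simp: zero_list_def plus_list_def)
end

abbreviation free_algebra :: "('g list \<Rightarrow>\<^sub>0 'k::comm_ring_1) ring" where
  "free_algebra \<equiv> ring_of_type_algebra"

abbreviation free_scale ::
    "'k::comm_ring_1 \<Rightarrow> ('g list \<Rightarrow>\<^sub>0 'k) \<Rightarrow> ('g list \<Rightarrow>\<^sub>0 'k)" where
  "free_scale c \<equiv> Poly_Mapping.map ((*) c)"

definition multilinear_relations ::
    "('k::comm_ring_1 \<Rightarrow> 'g::ab_group_add \<Rightarrow> 'g) \<Rightarrow> ('g list \<Rightarrow>\<^sub>0 'k) set" where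
  "multilinear_relations scale =
     {Poly_Mapping.single (us @ [x + y] @ vs) 1 - Poly_Mapping.single (us @ [x] @ vs) 1
        - Poly_Mapping.single (us @ [y] @ vs) 1 | us x y vs. True} \<union>
     {Poly_Mapping.single (us @ [scale c x] @ vs) 1 - Poly_Mapping.single (us @ [x] @ vs) c
        | us c x vs. True}"

text \<open>Every relation only involves words of one length \<open>n\<close>, so the submodule
  below is the direct sum over \<open>n\<close> of the submodules defining the \<open>n\<close>-fold tensor
  powers, and the quotient by it is the direct sum of the tensor powers.\<close>

definition tensor_null ::
    "('k::comm_ring_1 \<Rightarrow> 'g::ab_group_add \<Rightarrow> 'g) \<Rightarrow> ('g list \<Rightarrow>\<^sub>0 'k) set" where
  "tensor_null scale = Modules.module.span free_scale (multilinear_relations scale)"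

abbreviation tensor_class :: "('k::comm_ring_1 \<Rightarrow> 'g::ab_group_add \<Rightarrow> 'g) \<Rightarrow>
    ('g list \<Rightarrow>\<^sub>0 'k) \<Rightarrow> ('g list \<Rightarrow>\<^sub>0 'k) set" where
  "tensor_class scale p \<equiv> tensor_null scale +>\<^bsub>free_algebra\<^esub> p"

text \<open>The ring part is \<open>free_algebra Quot tensor_null scale\<close>; see
  \<open>tensor_algebra_truncate\<close> below.\<close>

definition tensor_algebra :: "('k::comm_ring_1 \<Rightarrow> 'g::ab_group_add \<Rightarrow> 'g) \<Rightarrow>
    ('k, ('g list \<Rightarrow>\<^sub>0 'k) set) module" where
  "tensor_algebra scale = ring.extend (free_algebra Quot tensor_null scale)
     (module.fields (\<lambda>c A. \<Union>p\<in>A. tensor_class scale (free_scale c p)))"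

definition pure_tensor :: "('k::comm_ring_1 \<Rightarrow> 'g::ab_group_add \<Rightarrow> 'g) \<Rightarrow>
    'g list \<Rightarrow> ('g list \<Rightarrow>\<^sub>0 'k) set" where
  "pure_tensor scale xs = tensor_class scale (Poly_Mapping.single xs 1)"

definition tensor_power :: "('k::comm_ring_1 \<Rightarrow> 'g::ab_group_add \<Rightarrow> 'g) \<Rightarrow>
    nat \<Rightarrow> ('g list \<Rightarrow>\<^sub>0 'k) set set" where
  "tensor_power scale n =
     tensor_class scale ` {p. \<forall>xs \<in> Poly_Mapping.keys p. length xs = n}"

text \<open>The action of a permutation of \<open>{..<n}\<close> on the \<open>n\<close>-fold tensor power,
  extended by the identity to the other degrees of the tensor algebra, so that it is
  well defined on cosets.\<close>

definition word_permute :: "nat \<Rightarrow> (nat \<Rightarrow> nat) \<Rightarrow> 'g list \<Rightarrow> 'g list" where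
  "word_permute n \<sigma> xs = (if length xs = n then permute_list \<sigma> xs else xs)"

definition free_permute ::
    "nat \<Rightarrow> (nat \<Rightarrow> nat) \<Rightarrow> ('g list \<Rightarrow>\<^sub>0 'k::comm_ring_1) \<Rightarrow> ('g list \<Rightarrow>\<^sub>0 'k)" where
  "free_permute n \<sigma> p = (\<Sum>xs \<in> Poly_Mapping.keys p.
     Poly_Mapping.single (word_permute n \<sigma> xs) (Poly_Mapping.lookup p xs))"

definition tensor_permute :: "('k::comm_ring_1 \<Rightarrow> 'g::ab_group_add \<Rightarrow> 'g) \<Rightarrow> nat \<Rightarrow>
    (nat \<Rightarrow> nat) \<Rightarrow> ('g list \<Rightarrow>\<^sub>0 'k) set \<Rightarrow> ('g list \<Rightarrow>\<^sub>0 'k) set" where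
  "tensor_permute scale n \<sigma> A = (\<Union>p\<in>A. tensor_class scale (free_permute n \<sigma> p))"

section \<open>The universal enveloping algebra\<close>

definition enveloping_ideal :: "('k::comm_ring_1 \<Rightarrow> 'g::ab_group_add \<Rightarrow> 'g) \<Rightarrow>
    ('g \<Rightarrow> 'g \<Rightarrow> 'g) \<Rightarrow> ('g list \<Rightarrow>\<^sub>0 'k) set set" where
  "enveloping_ideal scale bracket = (let T = tensor_algebra scale; t = pure_tensor scale in
     genideal T {t [x] \<otimes>\<^bsub>T\<^esub> t [y] \<ominus>\<^bsub>T\<^esub> t [y] \<otimes>\<^bsub>T\<^esub> t [x] \<ominus>\<^bsub>T\<^esub> t [bracket x y] | x y. True})"

definition enveloping_algebra :: "('k::comm_ring_1 \<Rightarrow> 'g::ab_group_add \<Rightarrow> 'g) \<Rightarrow>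
    ('g \<Rightarrow> 'g \<Rightarrow> 'g) \<Rightarrow> ('g list \<Rightarrow>\<^sub>0 'k) set set ring" where
  "enveloping_algebra scale bracket = tensor_algebra scale Quot enveloping_ideal scale bracket"

definition enveloping_map :: "('k::comm_ring_1 \<Rightarrow> 'g::ab_group_add \<Rightarrow> 'g) \<Rightarrow>
    ('g \<Rightarrow> 'g \<Rightarrow> 'g) \<Rightarrow> ('g list \<Rightarrow>\<^sub>0 'k) set \<Rightarrow> ('g list \<Rightarrow>\<^sub>0 'k) set set" where
  "enveloping_map scale bracket A =
     enveloping_ideal scale bracket +>\<^bsub>tensor_algebra scale\<^esub> A"

definition enveloping_incl :: "('k::comm_ring_1 \<Rightarrow> 'g::ab_group_add \<Rightarrow> 'g) \<Rightarrow>
    ('g \<Rightarrow> 'g \<Rightarrow> 'g) \<Rightarrow> 'g \<Rightarrow> ('g list \<Rightarrow>\<^sub>0 'k) set set" where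
  "enveloping_incl scale bracket x = enveloping_map scale bracket (pure_tensor scale [x])"

section \<open>Well-definedness of the constructions\<close>

lemma type_ring_simps:
  "carrier ring_of_type_algebra = UNIV" "monoid.mult ring_of_type_algebra = (*)"
  "monoid.one ring_of_type_algebra = 1" "ring.zero ring_of_type_algebra = 0"
  "ring.add ring_of_type_algebra = (+)"
  by (simp_all add: ring_of_type_algebra_def fun_eq_iff)

lemma free_algebra_simps:
  "carrier free_algebra = UNIV" "monoid.mult free_algebra = (*)" "monoid.one free_algebra = 1"
  "ring.zero free_algebra = 0" "ring.add free_algebra = (+)"
  by (simp_all add: ring_of_type_algebra_def fun_eq_iff)

lemma free_algebra_ring: "ring (free_algebra :: ('g list \<Rightarrow>\<^sub>0 'k::comm_ring_1) ring)"
proof (rule ringI)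
  show "abelian_group (free_algebra :: ('g list \<Rightarrow>\<^sub>0 'k) ring)"
  proof (rule abelian_groupI)
    fix x :: "'g list \<Rightarrow>\<^sub>0 'k"
    show "\<exists>y\<in>carrier free_algebra. y \<oplus>\<^bsub>free_algebra\<^esub> x = \<zero>\<^bsub>free_algebra\<^esub>"
      by (rule bexI[of _ "- x"]) (simp_all add: free_algebra_simps)
  qed (simp_all add: free_algebra_simps algebra_simps)
  show "monoid (free_algebra :: ('g list \<Rightarrow>\<^sub>0 'k) ring)"
    by (rule monoidI) (simp_all add: free_algebra_simps algebra_simps)
qed (simp_all add: free_algebra_simps algebra_simps)

lemma free_scale_eq: "free_scale c p = Poly_Mapping.single [] c * p"
  using mult_map_scale_conv_mult[of c p] by (simp add: zero_list_def)

lemma single_mult: "Poly_Mapping.single us c * Poly_Mapping.single vs d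
    = Poly_Mapping.single (us @ vs) (c * d)" for c :: "'k::comm_ring_1"
  by (simp add: mult_single plus_list_def)

lemma single_Nil_1: "Poly_Mapping.single [] (1::'k::comm_ring_1) = 1"
  using single_one[where 'a="'a list" and 'b='k] by (simp add: zero_list_def)

lemma free_scale_module: "Modules.module (free_scale :: 'k::comm_ring_1 \<Rightarrow> ('g list \<Rightarrow>\<^sub>0 'k) \<Rightarrow> _)"
  by standard (simp_all add: free_scale_eq algebra_simps single_add single_Nil_1
      mult.assoc[symmetric] single_mult)

lemma poly_mapping_induct_single:
  fixes p :: "'a \<Rightarrow>\<^sub>0 'b::ab_group_add"
  assumes "P 0" "\<And>k c q. P q \<Longrightarrow> P (Poly_Mapping.single k c + q)"
  shows "P p"
proof (induction "card (Poly_Mapping.keys p)" arbitrary: p)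
  case 0 then show ?case using assms by simp
next
  case (Suc n)
  then obtain k where k: "k \<in> Poly_Mapping.keys p" by (metis card.empty empty_iff subsetI subset_antisym nat.distinct(1) ex_in_conv)
  define q where "q = p - Poly_Mapping.single k (Poly_Mapping.lookup p k)"
  have "Poly_Mapping.keys q = Poly_Mapping.keys p - {k}"
    by (auto simp: q_def in_keys_iff lookup_minus lookup_single when_def split: if_splits)
  hence "n = card (Poly_Mapping.keys q)" using Suc(2) k by simp
  hence "P q" by (rule Suc(1))
  moreover have "p = Poly_Mapping.single k (Poly_Mapping.lookup p k) + q" by (simp add: q_def)
  ultimately show ?case using assms(2) by metis
qed

lemma free_scale_mult:
  fixes x r :: "'g list \<Rightarrow>\<^sub>0 'k::comm_ring_1"
  shows "free_scale c x * r = free_scale c (x * r)" "r * free_scale c x = free_scale c (r * x)"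
proof -
  have comm: "r * Poly_Mapping.single [] c = Poly_Mapping.single [] c * r"
    by (induction r rule: poly_mapping_induct_single)
      (simp_all add: distrib_left distrib_right single_mult mult.commute)
  show "free_scale c x * r = free_scale c (x * r)"
    by (simp only: free_scale_eq mult.assoc)
  show "r * free_scale c x = free_scale c (r * x)"
    by (simp only: free_scale_eq mult.assoc[symmetric] comm)
qed

lemma multilinear_relations_mult:
  assumes "r \<in> multilinear_relations scale"
  shows "Poly_Mapping.single w 1 * r \<in> multilinear_relations scale"
    and "r * Poly_Mapping.single w 1 \<in> multilinear_relations scale"
proof -
  consider (add) us x y vs where "r = Poly_Mapping.single (us @ [x + y] @ vs) 1
        - Poly_Mapping.single (us @ [x] @ vs) 1 - Poly_Mapping.single (us @ [y] @ vs) 1"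
    | (scale) us c x vs where "r = Poly_Mapping.single (us @ [scale c x] @ vs) 1
        - Poly_Mapping.single (us @ [x] @ vs) c"
    using assms unfolding multilinear_relations_def by blast
  then have "Poly_Mapping.single w 1 * r \<in> multilinear_relations scale \<and>
      r * Poly_Mapping.single w 1 \<in> multilinear_relations scale"
  proof cases
    case add
    have "Poly_Mapping.single w 1 * r = Poly_Mapping.single ((w @ us) @ [x + y] @ vs) 1
        - Poly_Mapping.single ((w @ us) @ [x] @ vs) 1 - Poly_Mapping.single ((w @ us) @ [y] @ vs) 1"
      by (simp add: add right_diff_distrib single_mult)
    moreover have "r * Poly_Mapping.single w 1 = Poly_Mapping.single (us @ [x + y] @ (vs @ w)) 1
        - Poly_Mapping.single (us @ [x] @ (vs @ w)) 1 - Poly_Mapping.single (us @ [y] @ (vs @ w)) 1"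
      by (simp add: add left_diff_distrib single_mult)
    ultimately show ?thesis unfolding multilinear_relations_def by blast
  next
    case scale
    have "Poly_Mapping.single w 1 * r = Poly_Mapping.single ((w @ us) @ [scale c x] @ vs) 1
        - Poly_Mapping.single ((w @ us) @ [x] @ vs) c"
      by (simp add: scale right_diff_distrib single_mult)
    moreover have "r * Poly_Mapping.single w 1 = Poly_Mapping.single (us @ [scale c x] @ (vs @ w)) 1
        - Poly_Mapping.single (us @ [x] @ (vs @ w)) c"
      by (simp add: scale left_diff_distrib single_mult)
    ultimately show ?thesis unfolding multilinear_relations_def by blast
  qed
  then show "Poly_Mapping.single w 1 * r \<in> multilinear_relations scale"
    and "r * Poly_Mapping.single w 1 \<in> multilinear_relations scale" by auto
qed

lemma tensor_null_closed:
  "0 \<in> tensor_null scale"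
  "p \<in> tensor_null scale \<Longrightarrow> q \<in> tensor_null scale \<Longrightarrow> p + q \<in> tensor_null scale"
  "p \<in> tensor_null scale \<Longrightarrow> q \<in> tensor_null scale \<Longrightarrow> p - q \<in> tensor_null scale"
  "p \<in> tensor_null scale \<Longrightarrow> - p \<in> tensor_null scale"
  "p \<in> tensor_null scale \<Longrightarrow> free_scale c p \<in> tensor_null scale"
  unfolding tensor_null_def
  by (fact Modules.module.span_zero[OF free_scale_module] Modules.module.span_add[OF free_scale_module]
      Modules.module.span_diff[OF free_scale_module] Modules.module.span_neg[OF free_scale_module]
      Modules.module.span_scale[OF free_scale_module])+

lemma tensor_null_base: "r \<in> multilinear_relations scale \<Longrightarrow> r \<in> tensor_null scale"
  unfolding tensor_null_def by (fact Modules.module.span_base[OF free_scale_module])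

lemma tensor_null_induct [consumes 1, case_names zero step]:
  assumes "p \<in> tensor_null scale" "P 0"
    and "\<And>c r q. r \<in> multilinear_relations scale \<Longrightarrow> q \<in> tensor_null scale \<Longrightarrow> P q \<Longrightarrow> P (free_scale c r + q)"
  shows "P p"
proof -
  have "p \<in> tensor_null scale \<and> P p"
    using assms(1)[unfolded tensor_null_def]
  proof (induction rule: Modules.module.span_induct_alt[OF free_scale_module, consumes 1])
    case 1 show ?case by (simp add: tensor_null_closed assms(2))
  next
    case (2 c r q) then show ?case
      using assms(3) tensor_null_closed(2,5) tensor_null_base by blast
  qed
  then show ?thesis ..
qed

lemma tensor_null_mult:
  fixes p q :: "'g::ab_group_add list \<Rightarrow>\<^sub>0 'k::comm_ring_1"
  assumes "p \<in> tensor_null scale"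
  shows "q * p \<in> tensor_null scale" "p * q \<in> tensor_null scale"
proof -
  have w: "Poly_Mapping.single w 1 * p \<in> tensor_null scale" "p * Poly_Mapping.single w 1 \<in> tensor_null scale" for w
    using assms
    by (induction rule: tensor_null_induct)
      (simp_all only: mult_zero_left mult_zero_right distrib_left distrib_right free_scale_mult
        tensor_null_closed tensor_null_base multilinear_relations_mult)
  have S: "Poly_Mapping.single w c = free_scale c (Poly_Mapping.single w 1)" for w :: "'g list" and c :: 'k
    by (simp add: free_scale_eq single_mult)
  have X: "Poly_Mapping.single w c * p \<in> tensor_null scale" "p * Poly_Mapping.single w c \<in> tensor_null scale" for w c
    by (simp_all only: S[of w c] free_scale_mult w tensor_null_closed)
  show "q * p \<in> tensor_null scale"
    by (induction q rule: poly_mapping_induct_single)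
       (simp_all only: mult_zero_left distrib_right X tensor_null_closed)
  show "p * q \<in> tensor_null scale"
    by (induction q rule: poly_mapping_induct_single)
       (simp_all only: mult_zero_right distrib_left X tensor_null_closed)
qed

lemma ideal_tensor_null:
  fixes scale :: "'k::comm_ring_1 \<Rightarrow> 'g::ab_group_add \<Rightarrow> 'g"
  shows "ideal (tensor_null scale) free_algebra"
proof (rule idealI[OF free_algebra_ring])
  interpret R: ring "free_algebra :: ('g list \<Rightarrow>\<^sub>0 'k) ring"
    by (rule free_algebra_ring)
  have inv: "inv\<^bsub>add_monoid free_algebra\<^esub> x = - x" for x :: "'g list \<Rightarrow>\<^sub>0 'k"
    using R.add.inv_equality[of "- x" x] by (simp add: free_algebra_simps a_inv_def)
  show "subgroup (tensor_null scale) (add_monoid free_algebra)"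
  proof
    fix x assume "x \<in> tensor_null scale"
    then show "inv\<^bsub>add_monoid free_algebra\<^esub> x \<in> tensor_null scale"
      by (simp only: inv tensor_null_closed)
  qed (simp_all add: free_algebra_simps tensor_null_closed)
qed (simp_all add: free_algebra_simps tensor_null_mult)

lemma tensor_algebra_truncate:
  "ring.truncate (tensor_algebra scale) = free_algebra Quot tensor_null scale"
  by (simp add: tensor_algebra_def ring.defs module.defs)

lemma tensor_class_eq: "tensor_class scale p = (\<lambda>q. q + p) ` tensor_null scale"
  by (auto simp: a_r_coset_def r_coset_def free_algebra_simps)

lemma tensor_class_eq_iff:
  fixes scale :: "'a::comm_ring_1 \<Rightarrow> 'b::ab_group_add \<Rightarrow> 'b"
  shows "tensor_class scale p = tensor_class scale q \<longleftrightarrow> p - q \<in> tensor_null scale"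
proof -
  note Z = tensor_null_closed(1-3)
  show ?thesis unfolding tensor_class_eq
  proof 
    assume "(\<lambda>r. r + p) ` tensor_null scale = (\<lambda>r. r + q) ` tensor_null scale"
    then have "0 + p \<in> (\<lambda>r. r + q) ` tensor_null scale" using Z(1) by blast
    thus "p - q \<in> tensor_null scale" by auto
  next
    assume A: "p - q \<in> tensor_null scale"
    show "(\<lambda>r. r + p) ` tensor_null scale = (\<lambda>r. r + q) ` tensor_null scale"
    proof (intro subset_antisym image_subsetI)
      fix r assume r: "r \<in> tensor_null scale"
      show "r + p \<in> (\<lambda>r. r + q) ` tensor_null scale"
        by (rule image_eqI[of _ _ "r + (p - q)"]) (simp_all add: Z(2) r A)
      show "r + q \<in> (\<lambda>r. r + p) ` tensor_null scale"
        by (rule image_eqI[of _ _ "r - (p - q)"]) (simp, rule Z(3)[OF r A])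
    qed
  qed
qed

lemma tensor_algebra_simps:
  "carrier (tensor_algebra scale) = range (tensor_class scale)"
  "ring.zero (tensor_algebra scale) = tensor_class scale 0"
  "monoid.one (tensor_algebra scale) = tensor_class scale 1"
  "ring.add (tensor_algebra scale) (tensor_class scale p) (tensor_class scale q) = tensor_class scale (p + q)"
  "monoid.mult (tensor_algebra scale) (tensor_class scale p) (tensor_class scale q) = tensor_class scale (p * q)"
proof -
  interpret I: ideal "tensor_null scale" free_algebra by (rule ideal_tensor_null)
  show "carrier (tensor_algebra scale) = range (tensor_class scale)"
    by (auto simp: tensor_algebra_def ring.defs module.defs FactRing_def A_RCOSETS_def RCOSETS_def a_r_coset_def free_algebra_simps)
  show "ring.zero (tensor_algebra scale) = tensor_class scale 0"
    by (simp add: tensor_algebra_def ring.defs module.defs FactRing_def tensor_class_eq)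
  show "monoid.one (tensor_algebra scale) = tensor_class scale 1"
    by (simp add: tensor_algebra_def ring.defs module.defs FactRing_def free_algebra_simps)
  show "ring.add (tensor_algebra scale) (tensor_class scale p) (tensor_class scale q) = tensor_class scale (p + q)"
    using I.a_rcos_sum[of p q]
    by (simp add: tensor_algebra_def ring.defs module.defs FactRing_def free_algebra_simps)
  show "monoid.mult (tensor_algebra scale) (tensor_class scale p) (tensor_class scale q) = tensor_class scale (p * q)"
    using I.rcoset_mult_add[of p q]
    by (simp add: tensor_algebra_def ring.defs module.defs FactRing_def free_algebra_simps)
qed

lemma smult_tensor_class:
  fixes scale :: "'a::comm_ring_1 \<Rightarrow> 'b::ab_group_add \<Rightarrow> 'b"
  shows "module.smult (tensor_algebra scale) c (tensor_class scale p) = tensor_class scale (free_scale c p)"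
proof -
  interpret F: Modules.module "free_scale :: 'a::comm_ring_1 \<Rightarrow> ('b::ab_group_add list \<Rightarrow>\<^sub>0 'a) \<Rightarrow> _"
    by (rule free_scale_module)
  note Z = tensor_null_closed(1,5)
  have "tensor_class scale (free_scale c q) = tensor_class scale (free_scale c p)" if "q \<in> tensor_class scale p" for q
    using that Z unfolding tensor_class_eq_iff by (auto simp: tensor_class_eq F.scale_right_distrib)
  moreover have "p \<in> tensor_class scale p" using Z by (force simp: tensor_class_eq)
  ultimately have "(\<Union>q\<in>tensor_class scale p. tensor_class scale (free_scale c q)) = tensor_class scale (free_scale c p)"
    by (intro UN_constant_eq ballI)
  then show ?thesis by (simp add: tensor_algebra_def ring.defs module.defs)
qed

lemma tensor_algebra_ring: "ring (tensor_algebra scale)"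
proof (rule ringI)
  show "abelian_group (tensor_algebra scale)"
  proof (rule abelian_groupI)
    fix A assume "A \<in> carrier (tensor_algebra scale)"
    then obtain p where "A = tensor_class scale p" by (auto simp: tensor_algebra_simps)
    then show "\<exists>B\<in>carrier (tensor_algebra scale). B \<oplus>\<^bsub>tensor_algebra scale\<^esub> A = \<zero>\<^bsub>tensor_algebra scale\<^esub>"
      by (intro bexI[of _ "tensor_class scale (- p)"]) (simp_all add: tensor_algebra_simps)
  qed (auto simp: tensor_algebra_simps add_ac)
  show "monoid (tensor_algebra scale)"
    by (rule monoidI) (auto simp: tensor_algebra_simps mult.assoc)
qed (auto simp: tensor_algebra_simps distrib_left distrib_right)

lemma tensor_algebra_module:
  fixes scale :: "'a::comm_ring_1 \<Rightarrow> 'b::ab_group_add \<Rightarrow> 'b"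
  shows "module ring_of_type_algebra (tensor_algebra scale)"
proof -
  interpret F: Modules.module "free_scale :: 'a::comm_ring_1 \<Rightarrow> ('b::ab_group_add list \<Rightarrow>\<^sub>0 'a) \<Rightarrow> _"
    by (rule free_scale_module)
  interpret T: ring "tensor_algebra scale" by (rule tensor_algebra_ring)
  show ?thesis
    by (rule moduleI[OF cring_from_type_algebra T.is_abelian_group])
       (auto simp: tensor_algebra_simps smult_tensor_class type_ring_simps
         F.scale_right_distrib F.scale_left_distrib)
qed

lemma free_permute_single [simp]:
  "free_permute n \<sigma> (Poly_Mapping.single xs c) = Poly_Mapping.single (word_permute n \<sigma> xs) c"
  by (simp add: free_permute_def)

lemma free_permute_add: "free_permute n \<sigma> (p + q) = free_permute n \<sigma> p + free_permute n \<sigma> q"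
proof -
  have *: "free_permute n \<sigma> r = (\<Sum>xs\<in>A. Poly_Mapping.single (word_permute n \<sigma> xs) (Poly_Mapping.lookup r xs))"
    if "finite A" "Poly_Mapping.keys r \<subseteq> A" for r A
    unfolding free_permute_def
    by (rule sum.mono_neutral_left) (use that in \<open>auto simp: in_keys_iff\<close>)
  let ?A = "Poly_Mapping.keys p \<union> Poly_Mapping.keys q"
  show ?thesis using Poly_Mapping.keys_add[of p q]
    by (simp add: *[of ?A] lookup_add single_add sum.distrib)
qed

lemma word_permute_factor:
  fixes us vs :: "'g list"
  assumes \<sigma>: "\<sigma> permutes {..<n}"
  obtains us' vs' where "\<And>x. word_permute n \<sigma> (us @ [x] @ vs) = us' @ [x] @ vs'"
proof (cases "length us + length vs + 1 = n")
  case True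
  then have "length us < n" by simp
  then obtain k where k: "k < n" "\<sigma> k = length us"
    using permutes_image[OF \<sigma>] by (metis image_iff lessThan_iff)
  have ne: "\<sigma> i \<noteq> length us" if "i \<noteq> k" for i
    using that k(2) permutes_inj[OF \<sigma>] by (metis injD)
  define f where "f = (\<lambda>i. (us @ vs) ! (if \<sigma> i < length us then \<sigma> i else \<sigma> i - 1))"
  have f: "(us @ [x] @ vs) ! \<sigma> i = f i" if "i \<noteq> k" for x i
    using ne[OF that] by (auto simp: f_def nth_append nth_Cons' not_less)
  have split: "[0..<n] = [0..<k] @ k # [Suc k..<n]"
    using k(1) upt_add_eq_append[of 0 k "n - k"] by (simp add: upt_conv_Cons)
  have "word_permute n \<sigma> (us @ [x] @ vs) = map f [0..<k] @ [x] @ map f [Suc k..<n]" for x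
  proof -
    have "word_permute n \<sigma> (us @ [x] @ vs) = map (\<lambda>i. (us @ [x] @ vs) ! \<sigma> i) [0..<n]"
      using True by (simp add: word_permute_def permute_list_def del: upt_Suc)
    also have "\<dots> = map (\<lambda>i. (us @ [x] @ vs) ! \<sigma> i) [0..<k] @ [x] @
        map (\<lambda>i. (us @ [x] @ vs) ! \<sigma> i) [Suc k..<n]"
      unfolding split by (simp add: k(2))
    also have "map (\<lambda>i. (us @ [x] @ vs) ! \<sigma> i) [0..<k] = map f [0..<k]"
      by (intro map_cong refl f) simp
    also have "map (\<lambda>i. (us @ [x] @ vs) ! \<sigma> i) [Suc k..<n] = map f [Suc k..<n]"
      by (intro map_cong refl f) simp
    finally show ?thesis .
  qed
  then show ?thesis by (rule that)
next
  case False
  then show ?thesis by (intro that[of us vs]) (simp add: word_permute_def)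
qed

lemma free_permute_0 [simp]: "free_permute n \<sigma> 0 = 0"
  by (simp add: free_permute_def)

lemma free_permute_diff: "free_permute n \<sigma> (p - q) = free_permute n \<sigma> p - free_permute n \<sigma> q"
  using free_permute_add[of n \<sigma> "p - q" q] by simp

lemma free_permute_scale: "free_permute n \<sigma> (free_scale c p) = free_scale c (free_permute n \<sigma> p)"
  by (induction p rule: poly_mapping_induct_single)
    (simp_all add: free_scale_eq distrib_left single_mult free_permute_add)

lemma free_permute_relations:
  assumes "\<sigma> permutes {..<n}" "r \<in> multilinear_relations scale"
  shows "free_permute n \<sigma> r \<in> multilinear_relations scale"
proof -
  consider (add) us x y vs where "r = Poly_Mapping.single (us @ [x + y] @ vs) 1
        - Poly_Mapping.single (us @ [x] @ vs) 1 - Poly_Mapping.single (us @ [y] @ vs) 1"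
    | (scale) us c x vs where "r = Poly_Mapping.single (us @ [scale c x] @ vs) 1
        - Poly_Mapping.single (us @ [x] @ vs) c"
    using assms(2) unfolding multilinear_relations_def by blast
  then show ?thesis
  proof cases
    case add
    obtain us' vs' where w: "\<And>x. word_permute n \<sigma> (us @ [x] @ vs) = us' @ [x] @ vs'"
      using word_permute_factor[OF assms(1)] by blast
    show ?thesis
      unfolding add free_permute_diff free_permute_single w multilinear_relations_def by blast
  next
    case scale
    obtain us' vs' where w: "\<And>x. word_permute n \<sigma> (us @ [x] @ vs) = us' @ [x] @ vs'"
      using word_permute_factor[OF assms(1)] by blast
    show ?thesis
      unfolding scale free_permute_diff free_permute_single w multilinear_relations_def by blast
  qed
qed

lemma permute_null:
  assumes "\<sigma> permutes {..<n}" "p \<in> tensor_null scale"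
  shows "free_permute n \<sigma> p \<in> tensor_null scale"
  using assms(2)
  by (induction rule: tensor_null_induct)
    (simp_all only: free_permute_0 free_permute_add free_permute_scale tensor_null_closed
      tensor_null_base free_permute_relations[OF assms(1)])

lemma tensor_permute_class:
  fixes scale :: "'k::comm_ring_1 \<Rightarrow> 'g::ab_group_add \<Rightarrow> 'g"
  assumes "\<sigma> permutes {..<n}"
  shows "tensor_permute scale n \<sigma> (tensor_class scale p) = tensor_class scale (free_permute n \<sigma> p)"
proof -
  have "tensor_class scale (free_permute n \<sigma> q) = tensor_class scale (free_permute n \<sigma> p)"
    if "q \<in> tensor_class scale p" for q
    using that permute_null[OF assms] unfolding tensor_class_eq_iff
    by (auto simp: tensor_class_eq free_permute_add)
  moreover have "p \<in> tensor_class scale p"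
    using tensor_null_closed(1) by (force simp: tensor_class_eq)
  ultimately show ?thesis
    unfolding tensor_permute_def by (intro UN_constant_eq ballI)
qed

lemma tensor_permute_pure_tensor:
  assumes "\<sigma> permutes {..<n}" "length xs = n"
  shows "tensor_permute scale n \<sigma> (pure_tensor scale xs) = pure_tensor scale (permute_list \<sigma> xs)"
  using assms by (simp add: pure_tensor_def tensor_permute_class word_permute_def)

lemma pure_tensor_carrier: "pure_tensor scale xs \<in> carrier (tensor_algebra scale)"
  by (auto simp: pure_tensor_def tensor_algebra_simps)

lemma pure_tensor_mult:
  "pure_tensor scale xs \<otimes>\<^bsub>tensor_algebra scale\<^esub> pure_tensor scale ys = pure_tensor scale (xs @ ys)"
  by (simp add: pure_tensor_def tensor_algebra_simps single_mult)

lemma enveloping_ideal: "ideal (enveloping_ideal scale bracket) (tensor_algebra scale)"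
proof -
  interpret T: ring "tensor_algebra scale" by (rule tensor_algebra_ring)
  show ?thesis
    unfolding enveloping_ideal_def Let_def
    by (intro T.genideal_ideal) (auto intro: pure_tensor_carrier)
qed

lemma enveloping_algebra_ring: "ring (enveloping_algebra scale bracket)"
  unfolding enveloping_algebra_def by (rule ideal.quotient_is_ring[OF enveloping_ideal])

lemma enveloping_map_hom:
  "enveloping_map scale bracket \<in> Ring.ring_hom (tensor_algebra scale) (enveloping_algebra scale bracket)"
  using ideal.rcos_ring_hom[OF enveloping_ideal]
  unfolding enveloping_algebra_def enveloping_map_def[abs_def] .

lemma enveloping_map_pure_tensor:
  "enveloping_map scale bracket (pure_tensor scale xs) =
     foldr (\<lambda>x u. enveloping_incl scale bracket x \<otimes>\<^bsub>enveloping_algebra scale bracket\<^esub> u) xs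
       \<one>\<^bsub>enveloping_algebra scale bracket\<^esub>"
proof (induction xs)
  case Nil
  have "pure_tensor scale [] = \<one>\<^bsub>tensor_algebra scale\<^esub>"
    by (simp add: pure_tensor_def tensor_algebra_simps single_Nil_1)
  then show ?case
    using ring_hom_one[OF enveloping_map_hom] by simp
next
  case (Cons x xs)
  have "enveloping_map scale bracket (pure_tensor scale (x # xs)) =
      enveloping_map scale bracket (pure_tensor scale [x] \<otimes>\<^bsub>tensor_algebra scale\<^esub> pure_tensor scale xs)"
    by (simp add: pure_tensor_mult)
  also have "\<dots> = enveloping_incl scale bracket x \<otimes>\<^bsub>enveloping_algebra scale bracket\<^esub>
      enveloping_map scale bracket (pure_tensor scale xs)"
    unfolding enveloping_incl_def
    by (rule ring_hom_mult[OF enveloping_map_hom]) (rule pure_tensor_carrier)+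
  finally show ?case using Cons by simp
qed

lemma enveloping_incl_bracket:
  "enveloping_incl scale bracket (bracket x y) =
     enveloping_incl scale bracket x \<otimes>\<^bsub>enveloping_algebra scale bracket\<^esub> enveloping_incl scale bracket y
     \<ominus>\<^bsub>enveloping_algebra scale bracket\<^esub>
     enveloping_incl scale bracket y \<otimes>\<^bsub>enveloping_algebra scale bracket\<^esub> enveloping_incl scale bracket x"
proof -
  let ?T = "tensor_algebra scale" and ?U = "enveloping_algebra scale bracket"
  let ?I = "enveloping_ideal scale bracket" and ?m = "enveloping_map scale bracket"
  let ?t = "pure_tensor scale"
  interpret T: ring ?T by (rule tensor_algebra_ring)
  interpret U: ring ?U by (rule enveloping_algebra_ring)
  interpret I: ideal ?I ?T by (rule enveloping_ideal)
  interpret m: ring_hom_ring ?T ?U ?m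
    by (rule ring_hom_ringI2[OF tensor_algebra_ring enveloping_algebra_ring enveloping_map_hom])
  note C = pure_tensor_carrier
  let ?c = "?t [x] \<otimes>\<^bsub>?T\<^esub> ?t [y] \<ominus>\<^bsub>?T\<^esub> ?t [y] \<otimes>\<^bsub>?T\<^esub> ?t [x]"
  have S: "{?t [x] \<otimes>\<^bsub>?T\<^esub> ?t [y] \<ominus>\<^bsub>?T\<^esub> ?t [y] \<otimes>\<^bsub>?T\<^esub> ?t [x] \<ominus>\<^bsub>?T\<^esub> ?t [bracket x y] | x y. True} \<subseteq> carrier ?T"
    by (auto intro: C)
  have "?c \<ominus>\<^bsub>?T\<^esub> ?t [bracket x y] \<in> ?I"
    unfolding enveloping_ideal_def Let_def by (rule subsetD[OF T.genideal_self[OF S]]) blast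
  then have "?m ?c = ?m (?t [bracket x y])"
    unfolding enveloping_map_def
    by (intro T.quotient_eq_iff_same_a_r_cos[OF enveloping_ideal, THEN iffD1] T.minus_closed T.m_closed C)
  moreover have "?m ?c = ?m (?t [x]) \<otimes>\<^bsub>?U\<^esub> ?m (?t [y]) \<ominus>\<^bsub>?U\<^esub> ?m (?t [y]) \<otimes>\<^bsub>?U\<^esub> ?m (?t [x])"
    unfolding a_minus_def
    by (simp only: m.hom_add m.hom_mult m.hom_a_inv T.m_closed T.a_inv_closed C)
  ultimately show ?thesis
    unfolding enveloping_incl_def by simp
qed

end

theory Submission
  imports Defs
begin

text \<open>The Adams operations \<open>\<Psi>\<^sup>k\<close>, the convolution powers of the identity for the unshuffle
  coproduct, act on the \<open>n\<close>-fold tensor power through the group algebra of the symmetric group.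
  They descend to the enveloping algebra, where they multiply elements of the Lie algebra by \<open>k\<close>.
  Since the enveloping map is injective on \<open>W\<close>, this gives \<open>\<Psi>\<^sup>k P = k P\<close> already in the tensor
  power. There the Dynkin operator \<open>D\<close> satisfies \<open>D * id = n\<close>, and as \<open>\<Psi>\<^sup>k\<close> is a coalgebra morphism,
  \<open>n k P = n \<Psi>\<^sup>k P\<close> is \<open>D \<Psi>\<^sup>k P = k D P\<close> plus products of two polynomials in \<open>k\<close> without
  constant term. Comparing linear coefficients in \<open>k\<close>, which is possible over the rationals,
  gives \<open>n P = D P\<close>.\<close>

section \<open>Sums over unshuffles\<close>

text \<open>Elements of tensor products are encoded by how functions evaluate on them: the coproduct
  \<open>\<Sum> u \<otimes> v\<close> of a word by \<open>unshuffle_sum\<close>, and its images under the \<open>k\<close>-th convolution powers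
  of \<open>id\<close> and of \<open>id\<close> minus the counit by \<open>adams_sum k\<close> and \<open>reduced_adams_sum k\<close>.\<close>

fun unshuffle_sum :: "'a list \<Rightarrow> ('a list \<Rightarrow> 'a list \<Rightarrow> 'b::comm_monoid_add) \<Rightarrow> 'b" where
  "unshuffle_sum [] B = B [] []"
| "unshuffle_sum (x # xs) B =
     unshuffle_sum xs (\<lambda>u v. B (x # u) v) + unshuffle_sum xs (\<lambda>u v. B u (x # v))"

fun adams_sum :: "nat \<Rightarrow> 'a list \<Rightarrow> ('a list \<Rightarrow> 'b::comm_monoid_add) \<Rightarrow> 'b" where
  "adams_sum 0 w f = (if w = [] then f [] else 0)"
| "adams_sum (Suc k) w f = unshuffle_sum w (\<lambda>u v. adams_sum k v (\<lambda>v'. f (u @ v')))"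

fun reduced_adams_sum :: "nat \<Rightarrow> 'a list \<Rightarrow> ('a list \<Rightarrow> 'b::comm_monoid_add) \<Rightarrow> 'b" where
  "reduced_adams_sum 0 w f = (if w = [] then f [] else 0)"
| "reduced_adams_sum (Suc j) w f =
     unshuffle_sum w (\<lambda>u v. if u = [] then 0 else reduced_adams_sum j v (\<lambda>v'. f (u @ v')))"

lemma unshuffle_sum_cong:
  assumes "\<And>u v. mset u + mset v = mset w \<Longrightarrow> B u v = C u v"
  shows "unshuffle_sum w B = unshuffle_sum w C"
  using assms
proof (induction w arbitrary: B C)
  case (Cons x w)
  have "unshuffle_sum w (\<lambda>u v. B (x # u) v) = unshuffle_sum w (\<lambda>u v. C (x # u) v)"
    by (rule Cons.IH) (simp add: Cons.prems)
  moreover have "unshuffle_sum w (\<lambda>u v. B u (x # v)) = unshuffle_sum w (\<lambda>u v. C u (x # v))"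
    by (rule Cons.IH) (simp add: Cons.prems)
  ultimately show ?case by simp
qed simp

lemma unshuffle_sum_closed:
  assumes "\<And>x y. C x \<Longrightarrow> C y \<Longrightarrow> C (x + y)"
    and "\<And>u v. mset u + mset v = mset w \<Longrightarrow> C (B u v)"
  shows "C (unshuffle_sum w B)"
  using assms(2)
proof (induction w arbitrary: B)
  case (Cons x w)
  show ?case unfolding unshuffle_sum.simps
    by (intro assms(1) Cons.IH) (simp_all add: Cons.prems)
qed simp

lemma unshuffle_sum_additive:
  fixes h :: "'b::comm_monoid_add \<Rightarrow> 'c::comm_monoid_add"
  assumes "\<And>x y. h (x + y) = h x + h y"
  shows "h (unshuffle_sum w B) = unshuffle_sum w (\<lambda>u v. h (B u v))"
  by (induction w arbitrary: B) (simp_all add: assms)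

lemma unshuffle_sum_0 [simp]: "unshuffle_sum w (\<lambda>u v. 0) = 0"
  by (induction w) simp_all

lemma unshuffle_sum_add:
  "unshuffle_sum w (\<lambda>u v. B u v + C u v) = unshuffle_sum w B + unshuffle_sum w C"
  by (induction w arbitrary: B C) (simp_all add: add_ac)

lemma unshuffle_sum_diff:
  "unshuffle_sum w (\<lambda>u v. B u v - C u v) = unshuffle_sum w B - unshuffle_sum w C"
  for B :: "'a list \<Rightarrow> 'a list \<Rightarrow> 'b::ab_group_add"
  by (induction w arbitrary: B C) simp_all

lemma unshuffle_sum_sum:
  "unshuffle_sum w (\<lambda>u v. \<Sum>i\<in>A. B i u v) = (\<Sum>i\<in>A. unshuffle_sum w (B i))"
  by (induction A rule: infinite_finite_induct) (simp_all add: unshuffle_sum_add)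

lemma unshuffle_sum_append:
  "unshuffle_sum (w @ w') B =
     unshuffle_sum w (\<lambda>u v. unshuffle_sum w' (\<lambda>u' v'. B (u @ u') (v @ v')))"
  by (induction w arbitrary: B) simp_all

lemma unshuffle_sum_map:
  "unshuffle_sum (map g w) B = unshuffle_sum w (\<lambda>u v. B (map g u) (map g v))"
  by (induction w arbitrary: B) simp_all

lemma unshuffle_sum_left_Nil:
  "unshuffle_sum w (\<lambda>u v. if u = [] then B v else 0) = B w"
  by (induction w arbitrary: B) simp_all

lemma unshuffle_sum_right_Nil:
  "unshuffle_sum w (\<lambda>u v. if v = [] then B u else 0) = B w"
  by (induction w arbitrary: B) simp_all

lemma unshuffle_sum_exchange:
  "unshuffle_sum w (\<lambda>a b. unshuffle_sum a (\<lambda>a1 a2. unshuffle_sum b (\<lambda>b1 b2. C a1 a2 b1 b2))) =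
   unshuffle_sum w (\<lambda>u v. unshuffle_sum u (\<lambda>u1 u2. unshuffle_sum v (\<lambda>v1 v2. C u1 v1 u2 v2)))"
proof (induction w arbitrary: C)
  case (Cons x w)
  show ?case
    unfolding unshuffle_sum.simps unshuffle_sum_add
    unfolding Cons.IH[of "\<lambda>p. C (x # p)"] Cons.IH[of "\<lambda>p q. C p (x # q)"]
      Cons.IH[of "\<lambda>p q r. C p q (x # r)"] Cons.IH[of "\<lambda>p q r s. C p q r (x # s)"]
    by (simp only: add_ac)
qed simp

lemma adams_sum_cong:
  assumes "\<And>q. mset q = mset w \<Longrightarrow> f q = g q"
  shows "adams_sum k w f = adams_sum k w g"
  using assms
proof (induction k arbitrary: f g w)
  case (Suc k)
  show ?case unfolding adams_sum.simps
    by (intro unshuffle_sum_cong Suc.IH Suc.prems) simp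
qed simp

lemma adams_sum_closed:
  assumes "\<And>x y. C x \<Longrightarrow> C y \<Longrightarrow> C (x + y)" "C 0"
    and "\<And>q. mset q = mset w \<Longrightarrow> C (f q)"
  shows "C (adams_sum k w f)"
  using assms(3)
proof (induction k arbitrary: f w)
  case (Suc k)
  show ?case unfolding adams_sum.simps
    by (rule unshuffle_sum_closed[of C, OF assms(1)]) (simp_all add: Suc.IH Suc.prems)
qed (simp add: assms(2))

lemma adams_sum_additive:
  fixes h :: "'b::comm_monoid_add \<Rightarrow> 'c::comm_monoid_add"
  assumes "\<And>x y. h (x + y) = h x + h y" "h 0 = 0"
  shows "h (adams_sum k w f) = adams_sum k w (\<lambda>q. h (f q))"
  by (induction k arbitrary: f w) (simp_all add: assms unshuffle_sum_additive[of h])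

lemma adams_sum_Nil [simp]: "adams_sum k [] f = f []"
  by (induction k arbitrary: f) simp_all

lemma adams_sum_0 [simp]: "adams_sum k w (\<lambda>q. 0) = 0"
  by (induction k arbitrary: w) simp_all

lemma adams_sum_add:
  "adams_sum k w (\<lambda>q. f q + g q) = adams_sum k w f + adams_sum k w g"
  by (induction k arbitrary: f g w) (simp_all add: unshuffle_sum_add)

lemma adams_sum_sum:
  "adams_sum k w (\<lambda>q. \<Sum>i\<in>A. f i q) = (\<Sum>i\<in>A. adams_sum k w (f i))"
  by (induction A rule: infinite_finite_induct) (simp_all add: adams_sum_add)

lemma adams_sum_map: "adams_sum k (map g w) f = adams_sum k w (\<lambda>q. f (map g q))"
  by (induction k arbitrary: f w) (simp_all add: unshuffle_sum_map)

lemma adams_sum_unshuffle_sum_commute: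
  "adams_sum k w (\<lambda>q. unshuffle_sum w' (\<lambda>u v. B u v q)) =
   unshuffle_sum w' (\<lambda>u v. adams_sum k w (B u v))"
  by (induction w' arbitrary: B) (simp_all add: adams_sum_add)

text \<open>By cocommutativity the Adams operations are morphisms of coalgebras.\<close>

lemma adams_sum_unshuffle_sum:
  "adams_sum k w (\<lambda>q. unshuffle_sum q B) =
   unshuffle_sum w (\<lambda>u v. adams_sum k u (\<lambda>u'. adams_sum k v (\<lambda>v'. B u' v')))"
proof (induction k arbitrary: B w)
  case 0
  have "unshuffle_sum w (\<lambda>u v. if u = [] then if v = [] then B [] [] else 0 else 0) =
      (if w = [] then B [] [] else 0)"
    by (rule unshuffle_sum_left_Nil)
  then show ?case by (simp cong: if_cong)
next
  case (Suc k)
  have "adams_sum (Suc k) w (\<lambda>q. unshuffle_sum q B) =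
      unshuffle_sum w (\<lambda>a b. unshuffle_sum a (\<lambda>a1 a2. unshuffle_sum b (\<lambda>b1 b2.
        adams_sum k b1 (\<lambda>u'. adams_sum k b2 (\<lambda>v'. B (a1 @ u') (a2 @ v'))))))"
    by (simp add: unshuffle_sum_append adams_sum_unshuffle_sum_commute Suc.IH)
  also have "\<dots> = unshuffle_sum w (\<lambda>u v. unshuffle_sum u (\<lambda>u1 u2. unshuffle_sum v (\<lambda>v1 v2.
        adams_sum k u2 (\<lambda>u'. adams_sum k v2 (\<lambda>v'. B (u1 @ u') (v1 @ v'))))))"
    by (rule unshuffle_sum_exchange)
  also have "\<dots> = unshuffle_sum w (\<lambda>u v. adams_sum (Suc k) u (\<lambda>u'. adams_sum (Suc k) v (\<lambda>v'. B u' v')))"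
  proof (rule unshuffle_sum_cong)
    fix u v
    have "unshuffle_sum u (\<lambda>u1 u2. unshuffle_sum v (\<lambda>v1 v2.
        adams_sum k u2 (\<lambda>u'. adams_sum k v2 (\<lambda>v'. B (u1 @ u') (v1 @ v'))))) =
      unshuffle_sum u (\<lambda>u1 u2. adams_sum k u2 (\<lambda>u'. adams_sum (Suc k) v (\<lambda>v'. B (u1 @ u') v')))"
      by (simp add: adams_sum_unshuffle_sum_commute)
    then show "unshuffle_sum u (\<lambda>u1 u2. unshuffle_sum v (\<lambda>v1 v2.
        adams_sum k u2 (\<lambda>u'. adams_sum k v2 (\<lambda>v'. B (u1 @ u') (v1 @ v'))))) =
      adams_sum (Suc k) u (\<lambda>u'. adams_sum (Suc k) v (\<lambda>v'. B u' v'))"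
      by simp
  qed
  finally show ?case .
qed

lemma reduced_adams_sum_0 [simp]: "reduced_adams_sum j w (\<lambda>q. 0) = 0"
  by (induction j arbitrary: w) (simp_all cong: if_cong)

lemma adams_sum_eq_reduced:
  fixes f :: "'a list \<Rightarrow> 'b::semiring_1"
  assumes "length w \<le> n"
  shows "adams_sum k w f = (\<Sum>j\<le>n. of_nat (k choose j) * reduced_adams_sum j w f)"
  using assms
proof (induction k arbitrary: f n w)
  case 0
  have "(\<Sum>j\<le>n. of_nat (0 choose j) * reduced_adams_sum j w f) =
      (\<Sum>j\<in>{0}. of_nat (0 choose j) * reduced_adams_sum j w f)"
    by (rule sum.mono_neutral_right) (auto simp: binomial_eq_0)
  then show ?case by simp
next
  case (Suc k)
  have len: "length v < length w" if "mset u + mset v = mset w" "u \<noteq> []" for u v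
    using that by (metis length_greater_0_conv less_add_same_cancel2 size_mset size_union)
  have nat: "{..n} = insert 0 (Suc ` {..<n})"
    by (metis lessThan_Suc_atMost lessThan_Suc_eq_insert_0)
  have S: "(\<Sum>j\<le>n. c j) = c 0 + (\<Sum>j<n. c (Suc j))" for c :: "nat \<Rightarrow> 'b"
    unfolding nat by (subst sum.insert) (auto simp: sum.reindex)
  have "adams_sum (Suc k) w f =
      unshuffle_sum w (\<lambda>u v. (if u = [] then adams_sum k v f else 0) +
        (if u = [] then 0 else adams_sum k v (\<lambda>v'. f (u @ v'))))"
    unfolding adams_sum.simps by (rule unshuffle_sum_cong) simp
  also have "\<dots> = adams_sum k w f +
      unshuffle_sum w (\<lambda>u v. \<Sum>j<n. of_nat (k choose j) *
        (if u = [] then 0 else reduced_adams_sum j v (\<lambda>v'. f (u @ v'))))"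
    unfolding unshuffle_sum_add unshuffle_sum_left_Nil
  proof (intro arg_cong2[of _ _ _ _ "(+)"] refl unshuffle_sum_cong)
    fix u v assume uv: "mset u + mset v = mset w"
    show "(if u = [] then 0 else adams_sum k v (\<lambda>v'. f (u @ v'))) =
      (\<Sum>j<n. of_nat (k choose j) * (if u = [] then 0 else reduced_adams_sum j v (\<lambda>v'. f (u @ v'))))"
    proof (cases "u = []")
      case False
      then have "length v \<le> n - 1" "{..n - 1} = {..<n}" using len[OF uv] Suc.prems by auto
      then show ?thesis using False Suc.IH[of v "n - 1"] by simp
    qed simp
  qed
  also have "\<dots> = (\<Sum>j\<le>n. of_nat (k choose j) * reduced_adams_sum j w f) +
      (\<Sum>j<n. of_nat (k choose j) * reduced_adams_sum (Suc j) w f)"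
    by (simp add: Suc.IH[OF Suc.prems] unshuffle_sum_sum
        unshuffle_sum_additive[of "(*) (of_nat _)"] distrib_left)
  also have "\<dots> = (\<Sum>j\<le>n. of_nat (Suc k choose j) * reduced_adams_sum j w f)"
    unfolding S by (simp add: distrib_right sum.distrib add_ac del: reduced_adams_sum.simps)
  finally show ?case .
qed

section \<open>Extraction of linear coefficients\<close>

lemma alternating_binomial_power_sum:
  assumes "m < d"
  shows "(\<Sum>k\<le>d. (- 1) ^ k * of_nat (d choose k) * of_nat k ^ m) = (0::'a::comm_ring_1)"
  using assms
proof (induction d arbitrary: m)
  case (Suc d)
  have pascal: "(\<Sum>k\<le>Suc d. (- 1) ^ k * of_nat (Suc d choose k) * f k) =
      (\<Sum>k\<le>d. (- 1) ^ k * of_nat (d choose k) * (f k - f (Suc k)))" for f :: "nat \<Rightarrow> 'a"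
  proof -
    have "(\<Sum>k\<le>Suc d. (- 1) ^ k * of_nat (Suc d choose k) * f k) =
        f 0 + (\<Sum>k\<le>d. (- 1) ^ Suc k * of_nat (d choose Suc k) * f (Suc k)) +
        (\<Sum>k\<le>d. (- 1) ^ Suc k * of_nat (d choose k) * f (Suc k))"
      by (simp add: sum.atMost_Suc_shift algebra_simps sum.distrib sum_negf sum_subtractf
          del: sum.atMost_Suc)
    also have "f 0 + (\<Sum>k\<le>d. (- 1) ^ Suc k * of_nat (d choose Suc k) * f (Suc k)) =
        (\<Sum>k\<le>Suc d. (- 1) ^ k * of_nat (d choose k) * f k)"
      by (simp add: sum.atMost_Suc_shift del: sum.atMost_Suc)
    also have "\<dots> = (\<Sum>k\<le>d. (- 1) ^ k * of_nat (d choose k) * f k)"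
      by (simp add: binomial_eq_0)
    finally show ?thesis
      by (simp add: right_diff_distrib sum_subtractf sum_negf)
  qed
  have step: "(of_nat k :: 'a) ^ m - of_nat (Suc k) ^ m = - (\<Sum>i<m. of_nat (m choose i) * of_nat k ^ i)"
    for k :: nat
  proof -
    have "of_nat (Suc k) ^ m = (\<Sum>i\<le>m. of_nat (m choose i) * of_nat k ^ i * (1::'a) ^ (m - i))"
      unfolding of_nat_Suc add.commute[of 1] by (rule binomial_ring)
    then show ?thesis by (simp add: lessThan_Suc_atMost[symmetric] algebra_simps)
  qed
  have "(\<Sum>k\<le>Suc d. (- 1) ^ k * of_nat (Suc d choose k) * of_nat k ^ m) =
      (\<Sum>k\<le>d. \<Sum>i<m. - (of_nat (m choose i) * ((- 1) ^ k * of_nat (d choose k) * (of_nat k :: 'a) ^ i)))"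
    unfolding pascal step by (simp add: sum_distrib_left sum_negf mult_ac)
  also have "\<dots> = (\<Sum>i<m. - (of_nat (m choose i) *
      (\<Sum>k\<le>d. (- 1) ^ k * of_nat (d choose k) * (of_nat k :: 'a) ^ i)))"
    by (subst sum.swap) (simp add: sum_distrib_left sum_negf)
  also have "\<dots> = 0"
    by (intro sum.neutral ballI) (use Suc in simp)
  finally show ?case .
qed simp

lemma alternating_binomial_poly_sum:
  fixes p :: "'a::comm_ring_1 poly"
  assumes "degree p < d"
  shows "(\<Sum>k\<le>d. (- 1) ^ k * of_nat (d choose k) * poly p (of_nat k)) = 0"
proof -
  have "(\<Sum>k\<le>d. (- 1) ^ k * of_nat (d choose k) * poly p (of_nat k)) =
     (\<Sum>i\<le>degree p. coeff p i * (\<Sum>k\<le>d. (- 1) ^ k * of_nat (d choose k) * of_nat k ^ i))"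
    by (simp add: poly_altdef sum_distrib_left mult_ac) (rule sum.swap)
  also have "\<dots> = 0"
    by (intro sum.neutral ballI) (use assms in \<open>simp add: alternating_binomial_power_sum\<close>)
  finally show ?thesis .
qed

lemma binomial_Suc_poly:
  "\<exists>c :: rat poly. degree c \<le> i \<and> (\<forall>k. of_nat (k choose Suc i) = of_nat k * poly c (of_nat k))"
proof (induction i)
  case 0
  show ?case by (rule exI[of _ 1]) simp
next
  case (Suc i)
  then obtain c :: "rat poly" where c: "degree c \<le> i"
      "\<And>k. of_nat (k choose Suc i) = of_nat k * poly c (of_nat k)" by blast
  let ?c = "smult (1 / of_nat (Suc (Suc i))) (c * [:- of_nat (Suc i), 1:])"
  have "degree ?c \<le> Suc i"
    using degree_mult_le[of c "[:- of_nat (Suc i), 1:]"] c(1) by simp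
  moreover have "of_nat (k choose Suc (Suc i)) = of_nat k * poly ?c (of_nat k)" for k
  proof -
    have "Suc (Suc i) * (k choose Suc (Suc i)) = (k - Suc i) * (k choose Suc i)"
      by (simp only: binomial_absorption binomial_absorb_comp)
    then have "of_nat (Suc (Suc i)) * of_nat (k choose Suc (Suc i)) =
        (of_nat (k - Suc i) * of_nat (k choose Suc i) :: rat)"
      by (metis of_nat_mult)
    also have "\<dots> = (of_nat k - of_nat (Suc i)) * of_nat (k choose Suc i)"
      by (cases "Suc i \<le> k") (simp_all add: of_nat_diff binomial_eq_0)
    finally show ?thesis by (simp add: c(2) field_simps del: binomial_Suc_Suc of_nat_Suc)
  qed
  ultimately show ?case by blast
qed

text \<open>The weights compute the derivative at \<open>0\<close> of a polynomial of degree at most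
  \<open>2 * n\<close> without constant term from its values at \<open>0, \<dots>, 2 * n\<close>; the products of two
  binomials have no linear term.\<close>

lemma ex_linear_coefficient_weights:
  assumes "n \<ge> 1"
  obtains c :: "nat \<Rightarrow> rat" where "(\<Sum>k\<le>2 * n. c k * of_nat k) = 1"
    and "\<And>i j. i \<in> {1..n} \<Longrightarrow> j \<in> {1..n} \<Longrightarrow>
      (\<Sum>k\<le>2 * n. c k * of_nat ((k choose i) * (k choose j))) = 0"
proof
  define c :: "nat \<Rightarrow> rat" where "c k = - ((- 1) ^ k * of_nat (2 * n choose k) / of_nat k)" for k
  have c: "c k * (of_nat k * x) = - ((- 1) ^ k * of_nat (2 * n choose k) * (if k = 0 then 0 else x))"
    for k x by (simp add: c_def)
  have "(\<Sum>k\<le>2 * n. c k * (of_nat k * 1)) =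
      - (\<Sum>k\<le>2 * n. (- 1) ^ k * of_nat (2 * n choose k) * (if k = 0 then 0 else 1))"
    unfolding c sum_negf ..
  also have "\<dots> = - ((\<Sum>k\<le>2 * n. (- 1) ^ k * of_nat (2 * n choose k)) - 1)"
  proof -
    have "(\<Sum>k\<le>2 * n. (- 1) ^ k * of_nat (2 * n choose k) * (if k = 0 then 0 else 1)) =
        (\<Sum>k\<le>2 * n. (- 1) ^ k * of_nat (2 * n choose k) - (if k = 0 then 1 else 0 :: rat))"
      by (rule sum.cong) auto
    then show ?thesis by (simp add: sum_subtractf)
  qed
  also have "\<dots> = 1"
    using assms by (simp add: choose_alternating_sum)
  finally show "(\<Sum>k\<le>2 * n. c k * of_nat k) = 1" by simp
  fix i j assume "i \<in> {1..n}" "j \<in> {1..n}"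
  then obtain i' j' where ij: "i = Suc i'" "j = Suc j'" "i' < n" "j' < n"
    by (cases i; cases j) auto
  obtain p :: "rat poly" where p: "degree p \<le> i'"
      "\<And>k. of_nat (k choose i) = of_nat k * poly p (of_nat k)"
    using binomial_Suc_poly[of i'] ij by blast
  obtain q :: "rat poly" where q: "degree q \<le> j'"
      "\<And>k. of_nat (k choose j) = of_nat k * poly q (of_nat k)"
    using binomial_Suc_poly[of j'] ij by blast
  let ?r = "pCons 0 (p * q)"
  have "degree ?r \<le> Suc (degree (p * q))" by (rule degree_pCons_le)
  with degree_mult_le[of p q] p(1) q(1) ij have deg: "degree ?r < 2 * n" by linarith
  have "c k * of_nat ((k choose i) * (k choose j)) =
      - ((- 1) ^ k * of_nat (2 * n choose k) * poly ?r (of_nat k))" for k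
  proof -
    have "c k * of_nat ((k choose i) * (k choose j)) = c k * (of_nat k * poly ?r (of_nat k))"
      by (simp add: p(2) q(2) mult_ac)
    also have "\<dots> = - ((- 1) ^ k * of_nat (2 * n choose k) * (if k = 0 then 0 else poly ?r (of_nat k)))"
      by (rule c)
    finally show ?thesis by (cases "k = 0") simp_all
  qed
  then show "(\<Sum>k\<le>2 * n. c k * of_nat ((k choose i) * (k choose j))) = 0"
    using alternating_binomial_poly_sum[OF deg] by (simp only: sum_negf neg_equal_0_iff_equal)
qed

section \<open>The Dynkin operator and the Adams operations on words\<close>

definition linear_extension ::
    "('a list \<Rightarrow> ('b list \<Rightarrow>\<^sub>0 'k::comm_ring_1)) \<Rightarrow> ('a list \<Rightarrow>\<^sub>0 'k) \<Rightarrow> ('b list \<Rightarrow>\<^sub>0 'k)" where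
  "linear_extension f p = (\<Sum>w\<in>Poly_Mapping.keys p. free_scale (Poly_Mapping.lookup p w) (f w))"

lemma linear_extension_single [simp]:
  "linear_extension f (Poly_Mapping.single w c) = free_scale c (f w)"
  by (simp add: linear_extension_def free_scale_eq)

lemma linear_extension_0 [simp]: "linear_extension f 0 = 0"
  by (simp add: linear_extension_def)

lemma linear_extension_add:
  "linear_extension f (p + q) = linear_extension f p + linear_extension f q"
proof -
  have *: "linear_extension f r = (\<Sum>w\<in>A. free_scale (Poly_Mapping.lookup r w) (f w))"
    if "finite A" "Poly_Mapping.keys r \<subseteq> A" for r A
    unfolding linear_extension_def
    by (rule sum.mono_neutral_left) (use that in \<open>auto simp: in_keys_iff free_scale_eq\<close>)
  let ?A = "Poly_Mapping.keys p \<union> Poly_Mapping.keys q"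
  show ?thesis using Poly_Mapping.keys_add[of p q]
    by (simp add: *[of ?A] lookup_add free_scale_eq single_add distrib_right sum.distrib)
qed

lemma linear_extension_diff:
  "linear_extension f (p - q) = linear_extension f p - linear_extension f q"
  using linear_extension_add[of f "p - q" q] by simp

lemma linear_extension_free_scale:
  "linear_extension f (free_scale c p) = free_scale c (linear_extension f p)"
  by (induction p rule: poly_mapping_induct_single)
    (simp_all add: free_scale_eq distrib_left single_mult linear_extension_add
      mult.assoc[symmetric])

lemma linear_extension_sum:
  "linear_extension f (\<Sum>i\<in>A. p i) = (\<Sum>i\<in>A. linear_extension f (p i))"
  by (induction A rule: infinite_finite_induct) (simp_all add: linear_extension_add)

lemma of_nat_eq_single: "of_nat m = Poly_Mapping.single [] (of_nat m :: 'k::comm_ring_1)"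
  by (induction m) (simp_all add: single_add single_Nil_1)

lemma free_scale_of_nat: "free_scale (of_nat m) p = of_nat m * p"
  by (simp only: free_scale_eq of_nat_eq_single)

lemma free_scale_1: "free_scale 1 p = p"
  using free_scale_of_nat[of 1 p] by simp

lemma free_scale_0: "free_scale c 0 = 0"
  by (simp add: free_scale_eq)

lemma free_scale_diff: "free_scale c (p - q) = free_scale c p - free_scale c q"
  by (simp add: free_scale_eq right_diff_distrib)

lemma linear_extension_of_nat_mult:
  "linear_extension f (of_nat m * p) = of_nat m * linear_extension f p"
  by (simp only: free_scale_of_nat[symmetric] linear_extension_free_scale)

fun dynkin :: "'a list \<Rightarrow> ('a list \<Rightarrow>\<^sub>0 'k::comm_ring_1)" where
  "dynkin [] = 0"
| "dynkin [x] = Poly_Mapping.single [x] 1"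
| "dynkin (x # y # ys) = Poly_Mapping.single [x] 1 * dynkin (y # ys)
     - dynkin (y # ys) * Poly_Mapping.single [x] 1"

lemma dynkin_Cons:
  "dynkin (x # w) = Poly_Mapping.single [x] 1 * dynkin w - dynkin w * Poly_Mapping.single [x] 1
     + (if w = [] then Poly_Mapping.single [x] 1 else 0)"
  by (cases w) simp_all

text \<open>In terms of convolution: \<open>dynkin * id\<close> is the grading operator. With the bracketing to the
  right used here, the order of the two factors matters.\<close>

lemma unshuffle_sum_dynkin:
  "unshuffle_sum w (\<lambda>u v. dynkin u * Poly_Mapping.single v 1) =
     of_nat (length w) * Poly_Mapping.single w (1::'k::comm_ring_1)"
proof (induction w)
  case (Cons x w)
  let ?s = "\<lambda>w. Poly_Mapping.single w (1::'k)"
  have comm: "?s [x] * of_nat m = of_nat m * ?s [x]" for m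
    by (simp add: mult_of_nat_commute)
  have "unshuffle_sum (x # w) (\<lambda>u v. dynkin u * ?s v) =
      unshuffle_sum w (\<lambda>u v. ?s [x] * (dynkin u * ?s v) + (if u = [] then ?s (x # v) else 0))"
    unfolding unshuffle_sum.simps unshuffle_sum_add[symmetric]
    by (rule unshuffle_sum_cong) (simp add: dynkin_Cons algebra_simps single_mult)
  also have "\<dots> = ?s [x] * (of_nat (length w) * ?s w) + ?s (x # w)"
    unfolding unshuffle_sum_add unshuffle_sum_left_Nil
    by (simp add: unshuffle_sum_additive[of "(*) (?s [x])", symmetric] distrib_left Cons.IH)
  also have "?s [x] * (of_nat (length w) * ?s w) = of_nat (length w) * ?s (x # w)"
    by (simp add: mult.assoc[symmetric] comm) (simp add: mult.assoc single_mult)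
  finally show ?case by (simp add: distrib_right add_ac)
qed simp

definition adams :: "nat \<Rightarrow> 'a list \<Rightarrow> ('a list \<Rightarrow>\<^sub>0 'k::comm_ring_1)" where
  "adams k w = adams_sum k w (\<lambda>q. Poly_Mapping.single q 1)"

text \<open>The coefficient of \<open>(k choose i) * (k choose j)\<close> in the part of the expansion below in which
  both factors of the coproduct are nontrivial.\<close>

definition adams_cross_term :: "nat \<Rightarrow> nat \<Rightarrow> 'a list \<Rightarrow> ('a list \<Rightarrow>\<^sub>0 'k::comm_ring_1)" where
  "adams_cross_term i j w = unshuffle_sum w (\<lambda>u v. if v = [] then 0 else
     reduced_adams_sum i u (\<lambda>u'. reduced_adams_sum j v (\<lambda>v'. dynkin u' * Poly_Mapping.single v' 1)))"

lemma linear_extension_adams: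
  "linear_extension f (adams k w) = adams_sum k w f"
  unfolding adams_def
  by (subst adams_sum_additive[of "linear_extension f"])
    (simp_all add: linear_extension_add free_scale_1)

lemma adams_cross_term_0:
  "adams_cross_term 0 j w = 0" "adams_cross_term i 0 w = 0"
  by (simp_all add: adams_cross_term_def cong: if_cong)

lemma adams_dynkin_expansion:
  fixes w :: "'a list"
  assumes "length w = n"
  shows "of_nat n * adams k w = linear_extension dynkin (adams k w) +
    (\<Sum>i\<in>{1..n}. \<Sum>j\<in>{1..n}. of_nat ((k choose i) * (k choose j)) *
       (adams_cross_term i j w :: 'a list \<Rightarrow>\<^sub>0 'k::comm_ring_1))"
proof -
  define B :: "'a list \<Rightarrow> 'a list \<Rightarrow> ('a list \<Rightarrow>\<^sub>0 'k)"
    where "B u v = dynkin u * Poly_Mapping.single v 1" for u v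
  have B: "B = (\<lambda>u v. dynkin u * Poly_Mapping.single v 1)"
    by (intro ext) (rule B_def)
  let ?c = "\<lambda>i. of_nat (k choose i) :: 'a list \<Rightarrow>\<^sub>0 'k"
  have expand: "adams_sum k u (\<lambda>u'. adams_sum k v (\<lambda>v'. B u' v')) =
      (\<Sum>i\<le>n. \<Sum>j\<le>n. of_nat ((k choose i) * (k choose j)) *
        reduced_adams_sum i u (\<lambda>u'. reduced_adams_sum j v (\<lambda>v'. B u' v')))"
    if "length u \<le> n" "length v \<le> n" for u v
  proof -
    have "adams_sum k u (\<lambda>u'. adams_sum k v (\<lambda>v'. B u' v')) =
        (\<Sum>j\<le>n. ?c j * adams_sum k u (\<lambda>u'. reduced_adams_sum j v (\<lambda>v'. B u' v')))"
      by (simp add: adams_sum_eq_reduced[OF that(2)] adams_sum_sum distrib_left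
          adams_sum_additive[of "(*) (?c _)"])
    also have "\<dots> = (\<Sum>j\<le>n. \<Sum>i\<le>n. of_nat ((k choose i) * (k choose j)) *
        reduced_adams_sum i u (\<lambda>u'. reduced_adams_sum j v (\<lambda>v'. B u' v')))"
      by (simp add: adams_sum_eq_reduced[OF that(1)] sum_distrib_left mult.assoc[symmetric]
          of_nat_mult[symmetric] mult.commute del: of_nat_mult)
    also have "\<dots> = (\<Sum>i\<le>n. \<Sum>j\<le>n. of_nat ((k choose i) * (k choose j)) *
        reduced_adams_sum i u (\<lambda>u'. reduced_adams_sum j v (\<lambda>v'. B u' v')))"
      by (rule sum.swap)
    finally show ?thesis .
  qed
  have "of_nat n * adams k w = adams_sum k w (\<lambda>q. of_nat n * (Poly_Mapping.single q 1 :: 'a list \<Rightarrow>\<^sub>0 'k))"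
    unfolding adams_def by (rule adams_sum_additive[of "(*) (of_nat n)"]) (simp_all add: distrib_left)
  also have "\<dots> = adams_sum k w (\<lambda>q. unshuffle_sum q B)"
  proof (rule adams_sum_cong)
    fix q assume "mset q = mset w"
    then have "length q = n" using assms by (metis size_mset)
    then show "of_nat n * Poly_Mapping.single q 1 = unshuffle_sum q B"
      by (simp only: B unshuffle_sum_dynkin)
  qed
  also have "\<dots> = unshuffle_sum w (\<lambda>u v. adams_sum k u (\<lambda>u'. adams_sum k v (\<lambda>v'. B u' v')))"
    by (rule adams_sum_unshuffle_sum)
  also have "\<dots> = unshuffle_sum w (\<lambda>u v. (if v = [] then adams_sum k u dynkin else 0) +
      (\<Sum>i\<le>n. \<Sum>j\<le>n. of_nat ((k choose i) * (k choose j)) * (if v = [] then 0 else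
        reduced_adams_sum i u (\<lambda>u'. reduced_adams_sum j v (\<lambda>v'. B u' v')))))"
  proof (rule unshuffle_sum_cong)
    fix u v assume "mset u + mset v = mset w"
    then have "length u + length v = n" using assms by (metis size_mset size_union)
    then show "adams_sum k u (\<lambda>u'. adams_sum k v (\<lambda>v'. B u' v')) =
        (if v = [] then adams_sum k u dynkin else 0) +
        (\<Sum>i\<le>n. \<Sum>j\<le>n. of_nat ((k choose i) * (k choose j)) * (if v = [] then 0 else
          reduced_adams_sum i u (\<lambda>u'. reduced_adams_sum j v (\<lambda>v'. B u' v'))))"
      using expand[of u v] by (cases "v = []") (simp_all add: B single_Nil_1)
  qed
  also have "\<dots> = linear_extension dynkin (adams k w) +
      (\<Sum>i\<le>n. \<Sum>j\<le>n. of_nat ((k choose i) * (k choose j)) * adams_cross_term i j w)"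
  proof -
    have "unshuffle_sum w (\<lambda>u v. c * D u v) = c * unshuffle_sum w D"
      for c :: "'a list \<Rightarrow>\<^sub>0 'k" and D
      by (rule sym, rule unshuffle_sum_additive[of "(*) c"]) (rule distrib_left)
    then show ?thesis
      by (simp only: unshuffle_sum_add unshuffle_sum_right_Nil linear_extension_adams unshuffle_sum_sum
          adams_cross_term_def B)
  qed
  also have "(\<Sum>i\<le>n. \<Sum>j\<le>n. of_nat ((k choose i) * (k choose j)) * adams_cross_term i j w) =
      (\<Sum>i\<in>{1..n}. \<Sum>j\<le>n. of_nat ((k choose i) * (k choose j)) *
        (adams_cross_term i j w :: 'a list \<Rightarrow>\<^sub>0 'k))"
    by (rule sum.mono_neutral_right) (auto simp: adams_cross_term_0 not_le less_Suc_eq)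
  also have "\<dots> = (\<Sum>i\<in>{1..n}. \<Sum>j\<in>{1..n}. of_nat ((k choose i) * (k choose j)) *
        (adams_cross_term i j w :: 'a list \<Rightarrow>\<^sub>0 'k))"
    by (intro sum.cong refl sum.mono_neutral_right) (auto simp: adams_cross_term_0 not_le less_Suc_eq)
  finally show ?thesis .
qed

lemma tensor_null_sum: "(\<And>i. i \<in> A \<Longrightarrow> f i \<in> tensor_null scale) \<Longrightarrow> sum f A \<in> tensor_null scale"
  by (induction A rule: infinite_finite_induct) (simp_all add: tensor_null_closed)

lemma contains_ratE:
  assumes "contains_rat TYPE('k::comm_ring_1)"
  obtains \<rho> :: "rat \<Rightarrow> 'k::comm_ring_1" where "\<rho> 1 = 1" "\<And>x y. \<rho> (x + y) = \<rho> x + \<rho> y"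
    "\<And>x y. \<rho> (x * y) = \<rho> x * \<rho> y" "\<And>m. \<rho> (of_nat m) = of_nat m"
    "\<And>(f :: nat \<Rightarrow> rat) A. \<rho> (sum f A) = (\<Sum>i\<in>A. \<rho> (f i))"
proof -
  obtain \<rho> :: "rat \<Rightarrow> 'k" where \<rho>: "\<rho> 1 = 1" "\<And>x y. \<rho> (x + y) = \<rho> x + \<rho> y"
      "\<And>x y. \<rho> (x * y) = \<rho> x * \<rho> y"
    using assms unfolding contains_rat_def by blast
  have 0: "\<rho> 0 = 0" using \<rho>(2)[of 0 0] by simp
  have "\<rho> (of_nat m) = of_nat m" for m
    by (induction m) (simp_all add: 0 \<rho>)
  moreover have "\<rho> (sum f A) = (\<Sum>i\<in>A. \<rho> (f i))" for f :: "nat \<Rightarrow> rat" and A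
    by (induction A rule: infinite_finite_induct) (simp_all add: 0 \<rho>)
  ultimately show ?thesis using \<rho> that by blast
qed

lemma tensor_null_linear_coefficient:
  fixes z :: "'g::ab_group_add list \<Rightarrow>\<^sub>0 'k::comm_ring_1"
  assumes "contains_rat TYPE('k)" "n \<ge> 1"
    and "\<And>k. of_nat k * z - (\<Sum>i\<in>{1..n}. \<Sum>j\<in>{1..n}. of_nat ((k choose i) * (k choose j)) * q i j)
      \<in> tensor_null scale"
  shows "z \<in> tensor_null scale"
proof -
  obtain \<rho> :: "rat \<Rightarrow> 'k" where \<rho>: "\<rho> 1 = 1" "\<And>x y. \<rho> (x + y) = \<rho> x + \<rho> y"
    "\<And>x y. \<rho> (x * y) = \<rho> x * \<rho> y" "\<And>m. \<rho> (of_nat m) = of_nat m"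
    "\<And>(f :: nat \<Rightarrow> rat) A. \<rho> (sum f A) = (\<Sum>i\<in>A. \<rho> (f i))"
    using contains_ratE[OF assms(1)] by blast
  have \<rho>0: "\<rho> 0 = 0" using \<rho>(2)[of 0 0] by simp
  obtain c :: "nat \<Rightarrow> rat" where c: "(\<Sum>k\<le>2 * n. c k * of_nat k) = 1"
    "\<And>i j. i \<in> {1..n} \<Longrightarrow> j \<in> {1..n} \<Longrightarrow>
      (\<Sum>k\<le>2 * n. c k * of_nat ((k choose i) * (k choose j))) = 0"
    using ex_linear_coefficient_weights[OF assms(2)] by blast
  let ?R = "\<lambda>x. Poly_Mapping.single [] (\<rho> x) :: 'g list \<Rightarrow>\<^sub>0 'k"
  have R_mult: "?R x * of_nat m = ?R (x * of_nat m)" for x m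
    by (simp add: of_nat_eq_single single_mult \<rho>)
  have single_sum: "Poly_Mapping.single [] (sum f A) = (\<Sum>i\<in>A. Poly_Mapping.single [] (f i))"
    for f :: "nat \<Rightarrow> 'k" and A
    by (induction A rule: infinite_finite_induct) (simp_all add: single_add)
  have R_sum: "(\<Sum>k\<in>A. ?R (f k)) = ?R (sum f A)" for f :: "nat \<Rightarrow> rat" and A
    by (simp add: \<rho>(5) single_sum)
  have collect: "(\<Sum>k\<le>2 * n. ?R (c k) * (of_nat (m k) * y)) = ?R (\<Sum>k\<le>2 * n. c k * of_nat (m k)) * y"
    for m y
    by (simp only: mult.assoc[symmetric] R_mult sum_distrib_right[symmetric] R_sum)
  have "(\<Sum>k\<le>2 * n. ?R (c k) * (of_nat k * z -
      (\<Sum>i\<in>{1..n}. \<Sum>j\<in>{1..n}. of_nat ((k choose i) * (k choose j)) * q i j))) \<in> tensor_null scale"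
    by (intro tensor_null_sum tensor_null_mult assms(3))
  also have "(\<Sum>k\<le>2 * n. ?R (c k) * (of_nat k * z -
      (\<Sum>i\<in>{1..n}. \<Sum>j\<in>{1..n}. of_nat ((k choose i) * (k choose j)) * q i j))) =
      (\<Sum>k\<le>2 * n. ?R (c k) * (of_nat k * z)) -
      (\<Sum>i\<in>{1..n}. \<Sum>j\<in>{1..n}. \<Sum>k\<le>2 * n. ?R (c k) * (of_nat ((k choose i) * (k choose j)) * q i j))"
  proof -
    have "(\<Sum>k\<le>2 * n. \<Sum>i\<in>{1..n}. \<Sum>j\<in>{1..n}. f k i j) =
        (\<Sum>i\<in>{1..n}. \<Sum>j\<in>{1..n}. \<Sum>k\<le>2 * n. f k i j)" for f :: "nat \<Rightarrow> nat \<Rightarrow> nat \<Rightarrow> 'g list \<Rightarrow>\<^sub>0 'k"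
      by (subst sum.swap, rule sum.cong, rule refl, rule sum.swap)
    then show ?thesis by (simp only: right_diff_distrib sum_subtractf sum_distrib_left)
  qed
  also have "\<dots> = ?R 1 * z - (\<Sum>i\<in>{1..n}. \<Sum>j\<in>{1..n}. ?R 0 * q i j)"
    unfolding collect c(1) by (intro arg_cong2[of _ _ _ _ "(-)"] sum.cong refl) (simp only: c(2))
  also have "\<dots> = z" by (simp add: \<rho> \<rho>0 single_Nil_1)
  finally show ?thesis .
qed

lemma dynkin_relation:
  fixes scale :: "'k::comm_ring_1 \<Rightarrow> 'g::ab_group_add \<Rightarrow> 'g"
  assumes "r \<in> multilinear_relations scale"
  shows "linear_extension dynkin r \<in> tensor_null scale"
proof -
  note Z = tensor_null_closed(2,3) tensor_null_mult
  consider (add) us x y vs where "r = Poly_Mapping.single (us @ [x + y] @ vs) 1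
        - Poly_Mapping.single (us @ [x] @ vs) 1 - Poly_Mapping.single (us @ [y] @ vs) 1"
    | (scale) us c x vs where "r = Poly_Mapping.single (us @ [scale c x] @ vs) 1
        - Poly_Mapping.single (us @ [x] @ vs) c"
    using assms unfolding multilinear_relations_def by blast
  then show ?thesis
  proof cases
    case add
    have "dynkin (us @ [x + y] @ vs) - dynkin (us @ [x] @ vs) - dynkin (us @ [y] @ vs) \<in> tensor_null scale"
    proof (induction us)
      case Nil
      let ?r = "Poly_Mapping.single [x + y] 1 - Poly_Mapping.single [x] 1 - Poly_Mapping.single [y] 1"
      have "Poly_Mapping.single ([] @ [x + y] @ []) 1 - Poly_Mapping.single ([] @ [x] @ []) 1
          - Poly_Mapping.single ([] @ [y] @ []) 1 \<in> tensor_null scale"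
        by (rule tensor_null_base) (unfold multilinear_relations_def, blast)
      then have r: "?r \<in> tensor_null scale" by simp
      have "?r * dynkin vs - dynkin vs * ?r + (if vs = [] then ?r else 0) \<in> tensor_null scale"
        by (intro Z(1) Z(2) Z(3)[OF r] Z(4)[OF r]) (use r in \<open>auto simp: tensor_null_closed(1)\<close>)
      then show ?case by (simp add: dynkin_Cons algebra_simps split: if_splits)
    next
      case (Cons u us)
      let ?s = "Poly_Mapping.single [u] (1::'k)"
      let ?d = "dynkin (us @ [x + y] @ vs) - dynkin (us @ [x] @ vs) - dynkin (us @ [y] @ vs)"
      have "dynkin ((u # us) @ [x + y] @ vs) - dynkin ((u # us) @ [x] @ vs) - dynkin ((u # us) @ [y] @ vs) =
          ?s * ?d - ?d * ?s"
        by (simp add: dynkin_Cons left_diff_distrib right_diff_distrib)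
      then show ?case
        by (simp only: Z(2)[OF Z(3)[OF Cons.IH] Z(4)[OF Cons.IH]])
    qed
    then show ?thesis by (simp add: add linear_extension_diff free_scale_1)
  next
    case scale
    have "dynkin (us @ [scale c x] @ vs) - free_scale c (dynkin (us @ [x] @ vs)) \<in> tensor_null scale"
    proof (induction us)
      case Nil
      have "Poly_Mapping.single ([] @ [scale c x] @ []) 1 - Poly_Mapping.single ([] @ [x] @ []) c
          \<in> tensor_null scale" (is "?r \<in> _")
        by (rule tensor_null_base) (unfold multilinear_relations_def, blast)
      moreover have "?r = Poly_Mapping.single [scale c x] 1 - free_scale c (Poly_Mapping.single [x] 1)"
        by (simp add: free_scale_eq single_mult)
      ultimately have r: "Poly_Mapping.single [scale c x] 1 - free_scale c (Poly_Mapping.single [x] 1)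
          \<in> tensor_null scale" (is "?s \<in> _") by simp
      have "?s * dynkin vs - dynkin vs * ?s + (if vs = [] then ?s else 0) \<in> tensor_null scale"
        by (intro Z(1) Z(2) Z(3)[OF r] Z(4)[OF r]) (use r in \<open>auto simp: tensor_null_closed(1)\<close>)
      moreover have "?s * dynkin vs - dynkin vs * ?s + (if vs = [] then ?s else 0) =
          dynkin ([] @ [scale c x] @ vs) - free_scale c (dynkin ([] @ [x] @ vs))"
        by (simp add: dynkin_Cons left_diff_distrib right_diff_distrib free_scale_mult free_scale_diff
            del: map_single)
      ultimately show ?case by simp
    next
      case (Cons u us)
      let ?s = "Poly_Mapping.single [u] (1::'k)"
      let ?d = "dynkin (us @ [scale c x] @ vs) - free_scale c (dynkin (us @ [x] @ vs))"
      have "dynkin ((u # us) @ [scale c x] @ vs) - free_scale c (dynkin ((u # us) @ [x] @ vs)) =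
          ?s * ?d - ?d * ?s"
        by (simp add: dynkin_Cons left_diff_distrib right_diff_distrib free_scale_mult free_scale_diff)
      then show ?case
        by (simp only: Z(2)[OF Z(3)[OF Cons.IH] Z(4)[OF Cons.IH]])
    qed
    then show ?thesis by (simp add: scale linear_extension_diff free_scale_1)
  qed
qed

lemma dynkin_null:
  "p \<in> tensor_null scale \<Longrightarrow> linear_extension dynkin p \<in> tensor_null scale"
  by (induction rule: tensor_null_induct)
    (simp_all add: linear_extension_add linear_extension_free_scale tensor_null_closed dynkin_relation)

lemma dynkin_of_adams_eigenvector:
  fixes p :: "'g::ab_group_add list \<Rightarrow>\<^sub>0 'k::comm_ring_1"
  assumes "contains_rat TYPE('k)" "n \<ge> 1"
    and p: "p = (\<Sum>l\<in>L. Poly_Mapping.single (w l) 1)" and len: "\<And>l. l \<in> L \<Longrightarrow> length (w l) = n"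
    and eigen: "\<And>k. linear_extension (adams k) p - of_nat k * p \<in> tensor_null scale"
  shows "of_nat n * p - linear_extension dynkin p \<in> tensor_null scale"
proof (rule tensor_null_linear_coefficient[OF assms(1,2)])
  fix k
  let ?a = "linear_extension (adams k) p"
  let ?q = "\<lambda>i j. \<Sum>l\<in>L. adams_cross_term i j (w l) :: 'g list \<Rightarrow>\<^sub>0 'k"
  have a: "?a = (\<Sum>l\<in>L. adams k (w l))"
    by (simp add: p linear_extension_sum free_scale_1)
  have "of_nat n * ?a = (\<Sum>l\<in>L. linear_extension dynkin (adams k (w l)) +
      (\<Sum>i\<in>{1..n}. \<Sum>j\<in>{1..n}. of_nat ((k choose i) * (k choose j)) * adams_cross_term i j (w l)))"
    unfolding a sum_distrib_left by (intro sum.cong refl adams_dynkin_expansion len)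
  also have "\<dots> = linear_extension dynkin ?a +
      (\<Sum>i\<in>{1..n}. \<Sum>j\<in>{1..n}. of_nat ((k choose i) * (k choose j)) * ?q i j)"
  proof -
    have "(\<Sum>l\<in>L. \<Sum>i\<in>{1..n}. \<Sum>j\<in>{1..n}. f l i j) =
        (\<Sum>i\<in>{1..n}. \<Sum>j\<in>{1..n}. \<Sum>l\<in>L. f l i j)" for f :: "_ \<Rightarrow> nat \<Rightarrow> nat \<Rightarrow> 'g list \<Rightarrow>\<^sub>0 'k"
      by (subst sum.swap, rule sum.cong, rule refl, rule sum.swap)
    then show ?thesis by (simp only: a linear_extension_sum sum.distrib sum_distrib_left)
  qed
  finally have E: "(\<Sum>i\<in>{1..n}. \<Sum>j\<in>{1..n}. of_nat ((k choose i) * (k choose j)) * ?q i j) =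
      of_nat n * ?a - linear_extension dynkin ?a" by simp
  let ?d = "?a - of_nat k * p"
  have "linear_extension dynkin ?d - of_nat n * ?d \<in> tensor_null scale"
    by (intro tensor_null_closed dynkin_null tensor_null_mult eigen)
  also have "linear_extension dynkin ?d - of_nat n * ?d =
      of_nat k * (of_nat n * p - linear_extension dynkin p) - (of_nat n * ?a - linear_extension dynkin ?a)"
  proof -
    have "of_nat n * (of_nat k * p) = of_nat k * (of_nat n * p)"
      by (simp only: mult.assoc[symmetric] of_nat_mult[symmetric] mult.commute[of n k])
    then show ?thesis
      by (simp add: linear_extension_diff linear_extension_of_nat_mult right_diff_distrib)
  qed
  finally show "of_nat k * (of_nat n * p - linear_extension dynkin p) -
      (\<Sum>i\<in>{1..n}. \<Sum>j\<in>{1..n}. of_nat ((k choose i) * (k choose j)) * ?q i j) \<in> tensor_null scale"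
    unfolding E .
qed

section \<open>Descent to the enveloping algebra\<close>

definition enveloping_null :: "('k::comm_ring_1 \<Rightarrow> 'g::ab_group_add \<Rightarrow> 'g) \<Rightarrow>
    ('g \<Rightarrow> 'g \<Rightarrow> 'g) \<Rightarrow> ('g list \<Rightarrow>\<^sub>0 'k) set" where
  "enveloping_null scale bracket = {p. tensor_class scale p \<in> enveloping_ideal scale bracket}"

lemma tensor_algebra_uminus:
  "\<ominus>\<^bsub>tensor_algebra scale\<^esub> tensor_class scale p = tensor_class scale (- p)"
proof -
  interpret T: ring "tensor_algebra scale" by (rule tensor_algebra_ring)
  show ?thesis by (rule T.minus_equality) (auto simp: tensor_algebra_simps)
qed

lemma tensor_algebra_minus:
  "tensor_class scale p \<ominus>\<^bsub>tensor_algebra scale\<^esub> tensor_class scale q = tensor_class scale (p - q)"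
  by (simp add: a_minus_def tensor_algebra_uminus tensor_algebra_simps)

lemma tensor_null_subset_enveloping_null: "tensor_null scale \<subseteq> enveloping_null scale bracket"
proof
  interpret I: ideal "enveloping_ideal scale bracket" "tensor_algebra scale" by (rule enveloping_ideal)
  fix p assume "p \<in> tensor_null scale"
  then have "tensor_class scale p = tensor_class scale 0" by (subst tensor_class_eq_iff) simp
  then show "p \<in> enveloping_null scale bracket"
    using additive_subgroup.zero_closed[OF I.is_additive_subgroup]
    by (simp add: enveloping_null_def tensor_algebra_simps)
qed

lemma enveloping_null_closed:
  "0 \<in> enveloping_null scale bracket"
  "p \<in> enveloping_null scale bracket \<Longrightarrow> q \<in> enveloping_null scale bracket \<Longrightarrow>
     p + q \<in> enveloping_null scale bracket"
  "p \<in> enveloping_null scale bracket \<Longrightarrow> q \<in> enveloping_null scale bracket \<Longrightarrow>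
     p - q \<in> enveloping_null scale bracket"
  "p \<in> enveloping_null scale bracket \<Longrightarrow> r * p \<in> enveloping_null scale bracket"
  "p \<in> enveloping_null scale bracket \<Longrightarrow> p * r \<in> enveloping_null scale bracket"
  "p \<in> enveloping_null scale bracket \<Longrightarrow> free_scale c p \<in> enveloping_null scale bracket"
proof -
  interpret I: ideal "enveloping_ideal scale bracket" "tensor_algebra scale" by (rule enveloping_ideal)
  have carrier: "tensor_class scale p \<in> carrier (tensor_algebra scale)" for p
    by (simp add: tensor_algebra_simps)
  show add: "p + q \<in> enveloping_null scale bracket"
    if "p \<in> enveloping_null scale bracket" "q \<in> enveloping_null scale bracket" for p q
    using that I.a_closed by (simp add: enveloping_null_def tensor_algebra_simps(4)[symmetric])
  show mult: "r * p \<in> enveloping_null scale bracket" if "p \<in> enveloping_null scale bracket" for p r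
    using that I.I_l_closed[OF _ carrier]
    by (simp add: enveloping_null_def tensor_algebra_simps(5)[symmetric])
  show "p * r \<in> enveloping_null scale bracket" if "p \<in> enveloping_null scale bracket" for p r
    using that I.I_r_closed[OF _ carrier]
    by (simp add: enveloping_null_def tensor_algebra_simps(5)[symmetric])
  show "0 \<in> enveloping_null scale bracket"
    using additive_subgroup.zero_closed[OF I.is_additive_subgroup]
    by (simp add: enveloping_null_def tensor_algebra_simps(2))
  show "p - q \<in> enveloping_null scale bracket"
    if "p \<in> enveloping_null scale bracket" "q \<in> enveloping_null scale bracket" for p q
    using add[OF that(1) mult[OF that(2), of "- 1"]] by simp
  show "free_scale c p \<in> enveloping_null scale bracket" if "p \<in> enveloping_null scale bracket" for p
    unfolding free_scale_eq by (rule mult[OF that])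
qed

lemma enveloping_null_sum:
  "(\<And>i. i \<in> A \<Longrightarrow> f i \<in> enveloping_null scale bracket) \<Longrightarrow> sum f A \<in> enveloping_null scale bracket"
  by (induction A rule: infinite_finite_induct) (simp_all add: enveloping_null_closed)

lemma enveloping_map_eq_iff:
  "enveloping_map scale bracket (tensor_class scale p) = enveloping_map scale bracket (tensor_class scale q)
     \<longleftrightarrow> p - q \<in> enveloping_null scale bracket"
proof -
  interpret T: ring "tensor_algebra scale" by (rule tensor_algebra_ring)
  show ?thesis
    unfolding enveloping_map_def enveloping_null_def mem_Collect_eq tensor_algebra_minus[symmetric]
    by (rule T.quotient_eq_iff_same_a_r_cos[OF enveloping_ideal, symmetric])
      (simp_all add: tensor_algebra_simps)
qed

lemma enveloping_generator:
  "pure_tensor scale [x] \<otimes>\<^bsub>tensor_algebra scale\<^esub> pure_tensor scale [y]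
     \<ominus>\<^bsub>tensor_algebra scale\<^esub> pure_tensor scale [y] \<otimes>\<^bsub>tensor_algebra scale\<^esub> pure_tensor scale [x]
     \<ominus>\<^bsub>tensor_algebra scale\<^esub> pure_tensor scale [bracket x y] =
   tensor_class scale (Poly_Mapping.single [x, y] 1 - Poly_Mapping.single [y, x] 1
     - Poly_Mapping.single [bracket x y] 1)"
  by (simp add: pure_tensor_mult) (simp add: pure_tensor_def tensor_algebra_minus)

lemma enveloping_null_bracket:
  "Poly_Mapping.single [x, y] 1 - Poly_Mapping.single [y, x] 1 - Poly_Mapping.single [bracket x y] 1
     \<in> enveloping_null scale bracket"
proof -
  interpret T: ring "tensor_algebra scale" by (rule tensor_algebra_ring)
  show ?thesis
    unfolding enveloping_null_def enveloping_ideal_def Let_def enveloping_generator mem_Collect_eq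
    by (rule subsetD[OF T.genideal_self]) (auto simp: tensor_algebra_simps)
qed

lemma enveloping_null_minimal:
  assumes add: "\<And>p q. p \<in> J \<Longrightarrow> q \<in> J \<Longrightarrow> p + q \<in> J"
    and mult: "\<And>p r. p \<in> J \<Longrightarrow> r * p \<in> J" "\<And>p r. p \<in> J \<Longrightarrow> p * r \<in> J"
    and null: "tensor_null scale \<subseteq> J"
    and rel: "\<And>x y. Poly_Mapping.single [x, y] 1 - Poly_Mapping.single [y, x] 1
      - Poly_Mapping.single [bracket x y] 1 \<in> J"
  shows "enveloping_null scale bracket \<subseteq> J"
proof -
  interpret T: ring "tensor_algebra scale" by (rule tensor_algebra_ring)
  have "0 \<in> J" using null tensor_null_closed(1) by blast
  have "ideal (tensor_class scale ` J) (tensor_algebra scale)"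
  proof (rule idealI[OF tensor_algebra_ring])
    show "subgroup (tensor_class scale ` J) (add_monoid (tensor_algebra scale))"
    proof (rule T.add.subgroupI)
      show "tensor_class scale ` J \<subseteq> carrier (tensor_algebra scale)"
        by (auto simp: tensor_algebra_simps)
      show "tensor_class scale ` J \<noteq> {}" using \<open>0 \<in> J\<close> by blast
      fix A B assume "A \<in> tensor_class scale ` J" "B \<in> tensor_class scale ` J"
      then obtain p q where pq: "A = tensor_class scale p" "B = tensor_class scale q" "p \<in> J" "q \<in> J"
        by blast
      show "A \<oplus>\<^bsub>tensor_algebra scale\<^esub> B \<in> tensor_class scale ` J"
        using add[OF pq(3,4)] by (simp add: pq tensor_algebra_simps)
    next
      fix A assume "A \<in> tensor_class scale ` J"
      then obtain p where p: "A = tensor_class scale p" "p \<in> J" by blast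
      show "\<ominus>\<^bsub>tensor_algebra scale\<^esub> A \<in> tensor_class scale ` J"
        using mult(1)[OF p(2), of "- 1"] by (simp add: p tensor_algebra_uminus)
    qed
  next
    fix A B assume "A \<in> tensor_class scale ` J" "B \<in> carrier (tensor_algebra scale)"
    then obtain p q where pq: "A = tensor_class scale p" "B = tensor_class scale q" "p \<in> J"
      by (auto simp: tensor_algebra_simps)
    show "B \<otimes>\<^bsub>tensor_algebra scale\<^esub> A \<in> tensor_class scale ` J"
      and "A \<otimes>\<^bsub>tensor_algebra scale\<^esub> B \<in> tensor_class scale ` J"
      using mult[OF pq(3)] by (simp_all add: pq tensor_algebra_simps)
  qed
  then have "enveloping_ideal scale bracket \<subseteq> tensor_class scale ` J"
    unfolding enveloping_ideal_def Let_def enveloping_generator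
    by (rule T.genideal_minimal) (use rel in blast)
  then show ?thesis
  proof (intro subsetI)
    fix p assume "enveloping_ideal scale bracket \<subseteq> tensor_class scale ` J"
      and "p \<in> enveloping_null scale bracket"
    then obtain q where "tensor_class scale p = tensor_class scale q" "q \<in> J"
      unfolding enveloping_null_def by blast
    then have "p - q \<in> J" "q \<in> J" using null by (auto simp: tensor_class_eq_iff)
    from add[OF this] show "p \<in> J" by simp
  qed
qed

lemma adams_Suc:
  "adams (Suc k) w = unshuffle_sum w (\<lambda>u v. Poly_Mapping.single u 1 * adams k v)"
proof -
  have "Poly_Mapping.single u 1 * adams_sum k v (\<lambda>q. Poly_Mapping.single q 1) =
      adams_sum k v (\<lambda>q. Poly_Mapping.single (u @ q) (1::'b::comm_ring_1))" for u v :: "'a list"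
    by (subst adams_sum_additive[of "(*) (Poly_Mapping.single u 1)"])
      (simp_all add: distrib_left single_mult)
  then show ?thesis by (simp add: adams_def)
qed

lemma adams_zero: "w \<noteq> [] \<Longrightarrow> adams 0 w = 0"
  by (simp add: adams_def)

lemma adams_singleton:
  "adams k [x] = (of_nat k * Poly_Mapping.single [x] 1 :: 'a list \<Rightarrow>\<^sub>0 'b::comm_ring_1)"
proof (induction k)
  case (Suc k)
  have "adams k [] = (1 :: 'a list \<Rightarrow>\<^sub>0 'b)" by (simp add: adams_def single_Nil_1)
  then show ?case by (simp add: adams_Suc Suc single_Nil_1 distrib_right)
qed (simp add: adams_def)

text \<open>The value of the convolution \<open>id * adams k\<close> on \<open>u r v\<close> when \<open>r\<close> has the coproduct
  \<open>r \<otimes> 1 + 1 \<otimes> r\<close>, as all defining relations do.\<close>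

definition adams_primitive ::
    "nat \<Rightarrow> 'a list \<Rightarrow> 'a list \<Rightarrow> ('a list \<Rightarrow>\<^sub>0 'k::comm_ring_1) \<Rightarrow> ('a list \<Rightarrow>\<^sub>0 'k)" where
  "adams_primitive k u v r = unshuffle_sum u (\<lambda>u1 u2. unshuffle_sum v (\<lambda>v1 v2.
     Poly_Mapping.single u1 1 * r * Poly_Mapping.single v1 1 * adams k (u2 @ v2) +
     Poly_Mapping.single (u1 @ v1) 1 *
       linear_extension (adams k) (Poly_Mapping.single u2 1 * r * Poly_Mapping.single v2 1)))"

lemma adams_primitive_diff:
  "adams_primitive k u v (r - s) = adams_primitive k u v r - adams_primitive k u v s"
  by (simp add: adams_primitive_def unshuffle_sum_diff[symmetric] linear_extension_diff algebra_simps)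

lemma adams_primitive_free_scale:
  "adams_primitive k u v (free_scale c r) = free_scale c (adams_primitive k u v r)"
proof -
  have "free_scale c (p + q) = free_scale c p + free_scale c q" for p q :: "'a list \<Rightarrow>\<^sub>0 'b"
    by (simp add: free_scale_eq distrib_left)
  then show ?thesis
    by (simp add: adams_primitive_def unshuffle_sum_additive[of "free_scale c"] free_scale_mult
        linear_extension_free_scale)
qed

lemma adams_primitive_letter:
  "adams_primitive k u v (Poly_Mapping.single [x] 1) = adams (Suc k) (u @ [x] @ v)"
  by (simp add: adams_primitive_def adams_Suc unshuffle_sum_append unshuffle_sum_add single_mult
      free_scale_1)

lemma adams_primitive_commutator:
  "adams_primitive k u v (Poly_Mapping.single [x, y] 1 - Poly_Mapping.single [y, x] 1) =
     adams (Suc k) (u @ [x, y] @ v) - adams (Suc k) (u @ [y, x] @ v)"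
proof -
  define H where "H x y = unshuffle_sum u (\<lambda>u1 u2. unshuffle_sum v (\<lambda>v1 v2.
      Poly_Mapping.single (u1 @ [x] @ v1) (1::'b) * adams k (u2 @ [y] @ v2)))" for x y
  have "adams (Suc k) (u @ [x, y] @ v) =
      adams_primitive k u v (Poly_Mapping.single [x, y] 1) + (H x y + H y x)" for x y
    by (simp add: H_def adams_primitive_def adams_Suc unshuffle_sum_append unshuffle_sum_add single_mult
        free_scale_1 add_ac)
  then show ?thesis by (simp add: adams_primitive_diff add_ac)
qed

lemma adams_primitive_closed:
  fixes r :: "'g::ab_group_add list \<Rightarrow>\<^sub>0 'k::comm_ring_1"
  assumes "r \<in> enveloping_null scale bracket"
    and "\<And>u v. linear_extension (adams k) (Poly_Mapping.single u 1 * r * Poly_Mapping.single v 1)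
      \<in> enveloping_null scale bracket"
  shows "adams_primitive k u v r \<in> enveloping_null scale bracket"
proof -
  have *: "unshuffle_sum w B \<in> enveloping_null scale bracket"
    if "\<And>u v. B u v \<in> enveloping_null scale bracket" for w :: "'g list" and B :: "'g list \<Rightarrow> 'g list \<Rightarrow> 'g list \<Rightarrow>\<^sub>0 'k"
    by (rule unshuffle_sum_closed) (auto intro: that enveloping_null_closed)
  show ?thesis
    unfolding adams_primitive_def by (intro * enveloping_null_closed assms)
qed

lemma adams_stable_of_primitive:
  fixes r :: "'g::ab_group_add list \<Rightarrow>\<^sub>0 'k::comm_ring_1"
  assumes r: "r \<in> enveloping_null scale bracket"
    and zero: "\<And>u v. linear_extension (adams 0) (Poly_Mapping.single u 1 * r * Poly_Mapping.single v 1) = 0"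
    and prim: "\<And>k u v. linear_extension (adams (Suc k)) (Poly_Mapping.single u 1 * r * Poly_Mapping.single v 1) =
      adams_primitive k u v r"
  shows "linear_extension (adams k) (Poly_Mapping.single u 1 * r * Poly_Mapping.single v 1)
      \<in> enveloping_null scale bracket"
proof (induction k arbitrary: u v)
  case 0
  show ?case unfolding zero by (rule enveloping_null_closed)
next
  case (Suc k)
  show ?case unfolding prim by (rule adams_primitive_closed[OF r Suc.IH])
qed

lemma adams_stable_bracket:
  "linear_extension (adams k) (Poly_Mapping.single u 1 *
      (Poly_Mapping.single [x, y] 1 - Poly_Mapping.single [y, x] 1 - Poly_Mapping.single [bracket x y] 1) *
      Poly_Mapping.single v 1) \<in> enveloping_null scale bracket"
  by (rule adams_stable_of_primitive[OF enveloping_null_bracket])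
    (simp_all add: left_diff_distrib right_diff_distrib single_mult linear_extension_diff free_scale_1
      adams_zero adams_primitive_letter adams_primitive_commutator
      adams_primitive_diff[of _ _ _ "_ - _"] del: map_single)

lemma adams_stable_relation:
  fixes scale :: "'k::comm_ring_1 \<Rightarrow> 'g::ab_group_add \<Rightarrow> 'g"
  assumes "r \<in> multilinear_relations scale"
  shows "linear_extension (adams k) (Poly_Mapping.single u 1 * r * Poly_Mapping.single v 1)
      \<in> enveloping_null scale bracket"
proof -
  have base: "r \<in> multilinear_relations scale \<Longrightarrow> r \<in> enveloping_null scale bracket" for r
    using tensor_null_base tensor_null_subset_enveloping_null by blast
  consider (add) us x y vs where "r = Poly_Mapping.single (us @ [x + y] @ vs) 1
        - Poly_Mapping.single (us @ [x] @ vs) 1 - Poly_Mapping.single (us @ [y] @ vs) 1"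
    | (scale) us c x vs where "r = Poly_Mapping.single (us @ [scale c x] @ vs) 1
        - Poly_Mapping.single (us @ [x] @ vs) c"
    using assms unfolding multilinear_relations_def by blast
  then show ?thesis
  proof cases
    case add
    let ?r = "Poly_Mapping.single [x + y] 1 - Poly_Mapping.single [x] 1 - Poly_Mapping.single [y] (1::'k)"
    have "Poly_Mapping.single ([] @ [x + y] @ []) 1 - Poly_Mapping.single ([] @ [x] @ []) 1
          - Poly_Mapping.single ([] @ [y] @ []) 1 \<in> enveloping_null scale bracket"
      by (rule base) (unfold multilinear_relations_def, blast)
    then have "?r \<in> enveloping_null scale bracket" by simp
    then have "linear_extension (adams k) (Poly_Mapping.single (u @ us) 1 * ?r * Poly_Mapping.single (vs @ v) 1)
        \<in> enveloping_null scale bracket"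
      by (rule adams_stable_of_primitive)
        (simp_all add: left_diff_distrib right_diff_distrib single_mult linear_extension_diff free_scale_1
          adams_zero adams_primitive_letter adams_primitive_diff)
    then show ?thesis by (simp add: add left_diff_distrib right_diff_distrib single_mult)
  next
    case scale
    let ?r = "Poly_Mapping.single [scale c x] 1 - free_scale c (Poly_Mapping.single [x] (1::'k))"
    have "Poly_Mapping.single ([] @ [scale c x] @ []) 1 - Poly_Mapping.single ([] @ [x] @ []) c
          \<in> enveloping_null scale bracket"
      by (rule base) (unfold multilinear_relations_def, blast)
    then have "?r \<in> enveloping_null scale bracket" by (simp add: free_scale_eq single_mult)
    then have "linear_extension (adams k) (Poly_Mapping.single (u @ us) 1 * ?r * Poly_Mapping.single (vs @ v) 1)
        \<in> enveloping_null scale bracket"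
      by (rule adams_stable_of_primitive)
        (simp_all only: left_diff_distrib right_diff_distrib single_mult linear_extension_diff free_scale_1
          free_scale_mult linear_extension_free_scale linear_extension_single append_assoc mult_1
          adams_primitive_letter adams_primitive_diff adams_primitive_free_scale, simp add: adams_zero free_scale_0)
    then show ?thesis
      by (simp add: scale left_diff_distrib right_diff_distrib single_mult free_scale_mult)
  qed
qed

lemma adams_enveloping_null:
  fixes p :: "'g::ab_group_add list \<Rightarrow>\<^sub>0 'k::comm_ring_1"
  assumes "p \<in> enveloping_null scale bracket"
  shows "linear_extension (adams k) p \<in> enveloping_null scale bracket"
proof -
  define J where "J = {p. \<forall>k u v. linear_extension (adams k)
    (Poly_Mapping.single u 1 * p * Poly_Mapping.single v 1) \<in> enveloping_null scale bracket}"
  have JI: "p \<in> J" if "\<And>k u v. linear_extension (adams k)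
    (Poly_Mapping.single u 1 * p * Poly_Mapping.single v 1) \<in> enveloping_null scale bracket" for p
    using that by (simp add: J_def)
  have JD: "linear_extension (adams k) (Poly_Mapping.single u 1 * p * Poly_Mapping.single v 1)
      \<in> enveloping_null scale bracket" if "p \<in> J" for k u v p
    using that by (simp add: J_def)
  have J0: "0 \<in> J" by (rule JI) (simp add: enveloping_null_closed)
  have Jadd: "p + q \<in> J" if "p \<in> J" "q \<in> J" for p q
    by (rule JI) (simp add: distrib_left distrib_right linear_extension_add enveloping_null_closed JD that)
  have Jscale: "free_scale c p \<in> J" if "p \<in> J" for c p
    by (rule JI) (simp add: free_scale_mult linear_extension_free_scale enveloping_null_closed JD that)
  have single: "Poly_Mapping.single w c = free_scale c (Poly_Mapping.single w 1)" for w :: "'g list" and c :: 'k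
    by (simp add: free_scale_eq single_mult)
  have Jl: "r * p \<in> J" if "p \<in> J" for p r
  proof (induction r rule: poly_mapping_induct_single)
    case (2 w c q)
    have "Poly_Mapping.single w 1 * p \<in> J"
      by (rule JI) (simp add: mult.assoc[symmetric] single_mult JD that)
    then have "Poly_Mapping.single w c * p \<in> J"
      unfolding single[of w c] free_scale_mult by (rule Jscale)
    then show ?case by (simp add: distrib_right Jadd 2)
  qed (simp add: J0)
  have Jr: "p * r \<in> J" if "p \<in> J" for p r
  proof (induction r rule: poly_mapping_induct_single)
    case (2 w c q)
    have "p * Poly_Mapping.single w 1 \<in> J"
      by (rule JI) (simp add: mult.assoc single_mult, simp add: mult.assoc[symmetric] JD that)
    then have "p * Poly_Mapping.single w c \<in> J"
      unfolding single[of w c] free_scale_mult by (rule Jscale)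
    then show ?case by (simp add: distrib_left Jadd 2)
  qed (simp add: J0)
  have "tensor_null scale \<subseteq> J"
  proof
    fix p assume "p \<in> tensor_null scale"
    then show "p \<in> J"
      by (induction rule: tensor_null_induct) (simp_all add: J0 Jadd Jscale JI adams_stable_relation)
  qed
  from enveloping_null_minimal[OF Jadd Jl Jr this JI[OF adams_stable_bracket]]
  have "enveloping_null scale bracket \<subseteq> J" .
  then show ?thesis
    using JD[of p k "[]" "[]"] assms by (auto simp: single_Nil_1)
qed

section \<open>Conclusion\<close>

lemma adams_class_in_permutation_closed:
  fixes w :: "'i \<Rightarrow> 'g::ab_group_add list" and scale :: "'k::comm_ring_1 \<Rightarrow> 'g \<Rightarrow> 'g"
  assumes W: "submodule W ring_of_type_algebra (tensor_algebra scale)"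
    and perm: "\<And>\<sigma> A. \<sigma> permutes {..<n} \<Longrightarrow> A \<in> W \<Longrightarrow> tensor_permute scale n \<sigma> A \<in> W"
    and len: "\<And>l. l \<in> L \<Longrightarrow> length (w l) = n"
    and p: "p = (\<Sum>l\<in>L. Poly_Mapping.single (w l) 1)" "tensor_class scale p \<in> W"
  shows "tensor_class scale (linear_extension (adams k) p) \<in> W"
proof -
  interpret W: submodule W ring_of_type_algebra "tensor_algebra scale" by (rule W)
  have free_permute_sum: "free_permute n \<sigma> (\<Sum>l\<in>L. f l) = (\<Sum>l\<in>L. free_permute n \<sigma> (f l))"
    for \<sigma> and f :: "'i \<Rightarrow> 'g list \<Rightarrow>\<^sub>0 'k"
    by (induction L rule: infinite_finite_induct) (simp_all add: free_permute_add)
  have "linear_extension (adams k) p = (\<Sum>l\<in>L. adams k (w l))"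
    by (simp add: p(1) linear_extension_sum free_scale_1)
  also have "\<dots> = (\<Sum>l\<in>L. adams_sum k [0..<n] (\<lambda>q. Poly_Mapping.single (map ((!) (w l)) q) 1))"
  proof (rule sum.cong[OF refl])
    fix l assume "l \<in> L"
    then have "w l = map ((!) (w l)) [0..<n]" using len map_nth by metis
    then have "adams k (w l) = adams k (map ((!) (w l)) [0..<n])" by simp
    then show "adams k (w l) = adams_sum k [0..<n] (\<lambda>q. Poly_Mapping.single (map ((!) (w l)) q) 1)"
      by (simp only: adams_def adams_sum_map)
  qed
  also have "\<dots> = adams_sum k [0..<n] (\<lambda>q. \<Sum>l\<in>L. Poly_Mapping.single (map ((!) (w l)) q) 1)"
    by (rule adams_sum_sum[symmetric])
  also have "tensor_class scale \<dots> \<in> W"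
  proof (rule adams_sum_closed[of "\<lambda>x. tensor_class scale x \<in> W"])
    show "tensor_class scale (x + y) \<in> W" if "tensor_class scale x \<in> W" "tensor_class scale y \<in> W" for x y
      using W.m_closed[OF that] by (simp add: tensor_algebra_simps)
    show "tensor_class scale 0 \<in> W"
      using W.one_closed by (simp add: tensor_algebra_simps)
    fix q :: "nat list" assume "mset q = mset [0..<n]"
    then obtain \<sigma> where \<sigma>: "\<sigma> permutes {..<n}" "permute_list \<sigma> [0..<n] = q"
      by (metis mset_eq_permutation length_upt diff_zero)
    have "(\<Sum>l\<in>L. Poly_Mapping.single (map ((!) (w l)) q) (1::'k)) = free_permute n \<sigma> p"
      unfolding p(1) free_permute_sum
    proof (rule sum.cong[OF refl])
      fix l assume "l \<in> L"
      then have "map ((!) (w l)) q = permute_list \<sigma> (w l)"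
        using permute_list_map[of \<sigma> "[0..<n]" "(!) (w l)"] \<sigma> len map_nth[of "w l"] by simp
      then show "Poly_Mapping.single (map ((!) (w l)) q) (1::'k) = free_permute n \<sigma> (Poly_Mapping.single (w l) 1)"
        using len[OF \<open>l \<in> L\<close>] by (simp add: word_permute_def)
    qed
    then show "tensor_class scale (\<Sum>l\<in>L. Poly_Mapping.single (map ((!) (w l)) q) 1) \<in> W"
      using perm[OF \<sigma>(1) p(2)] by (simp add: tensor_permute_class[OF \<sigma>(1)])
  qed
  finally show ?thesis .
qed

lemma dynkin_left_bracket:
  fixes scale :: "'k::comm_ring_1 \<Rightarrow> 'g::ab_group_add \<Rightarrow> 'g"
  assumes "w \<noteq> []"
  shows "dynkin w - Poly_Mapping.single [left_bracket bracket w] 1 \<in> enveloping_null scale bracket"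
  using assms
proof (induction w rule: dynkin.induct)
  case (3 x y ys)
  let ?X = "Poly_Mapping.single [x] (1::'k)" and ?d = "dynkin (y # ys)"
  let ?b = "left_bracket bracket (y # ys)"
  let ?e = "?d - Poly_Mapping.single [?b] 1"
  have e: "?e \<in> enveloping_null scale bracket" using 3 by simp
  have "?X * ?e - ?e * ?X + (Poly_Mapping.single [x, ?b] 1 - Poly_Mapping.single [?b, x] 1
      - Poly_Mapping.single [bracket x ?b] 1) \<in> enveloping_null scale bracket"
    by (intro enveloping_null_closed(2,3) enveloping_null_closed(4,5)[OF e] enveloping_null_bracket)
  then show ?case by (simp add: left_diff_distrib right_diff_distrib single_mult algebra_simps)
qed (simp_all add: enveloping_null_closed)

lemma single_sum_letter:
  fixes scale :: "'k::comm_ring_1 \<Rightarrow> 'g::ab_group_add \<Rightarrow> 'g" and f :: "'i \<Rightarrow> 'g"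
  shows "(\<Sum>l\<in>L. Poly_Mapping.single [f l] 1) - Poly_Mapping.single [\<Sum>l\<in>L. f l] 1 \<in> tensor_null scale"
proof -
  have add: "Poly_Mapping.single [x + y] 1 - Poly_Mapping.single [x] 1 - Poly_Mapping.single [y] (1::'k)
      \<in> tensor_null scale" for x y
  proof -
    have "Poly_Mapping.single ([] @ [x + y] @ []) 1 - Poly_Mapping.single ([] @ [x] @ []) 1
        - Poly_Mapping.single ([] @ [y] @ []) 1 \<in> tensor_null scale"
      by (rule tensor_null_base) (unfold multilinear_relations_def, blast)
    then show ?thesis by simp
  qed
  have zero: "0 - Poly_Mapping.single [0] (1::'k) \<in> tensor_null scale"
    using add[of 0 0] by simp
  show ?thesis
  proof (induction L rule: infinite_finite_induct)
    case (insert l L)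
    from tensor_null_closed(3)[OF insert.IH add[of "f l" "sum f L"]] insert.hyps
    show ?case by (simp add: algebra_simps)
  qed (use zero in simp_all)
qed

lemma finsum_tensor_class:
  assumes "finite L"
  shows "(\<Oplus>\<^bsub>tensor_algebra scale\<^esub>l\<in>L. tensor_class scale (f l)) = tensor_class scale (\<Sum>l\<in>L. f l)"
proof -
  interpret T: ring "tensor_algebra scale" by (rule tensor_algebra_ring)
  show ?thesis
    using assms by (induction L) (simp_all add: tensor_algebra_simps)
qed

lemma add_pow_enveloping_map:
  "[n] \<cdot>\<^bsub>enveloping_algebra scale bracket\<^esub> enveloping_map scale bracket (tensor_class scale p) =
     enveloping_map scale bracket (tensor_class scale (of_nat n * p))"
proof -
  interpret T: ring "tensor_algebra scale" by (rule tensor_algebra_ring)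
  interpret U: ring "enveloping_algebra scale bracket" by (rule enveloping_algebra_ring)
  interpret m: ring_hom_ring "tensor_algebra scale" "enveloping_algebra scale bracket" "enveloping_map scale bracket"
    by (rule ring_hom_ringI2[OF tensor_algebra_ring enveloping_algebra_ring enveloping_map_hom])
  have carrier: "tensor_class scale q \<in> carrier (tensor_algebra scale)" for q
    by (simp add: tensor_algebra_simps)
  show ?thesis
  proof (induction n)
    case 0
    show ?case using m.hom_zero by (simp add: tensor_algebra_simps)
  next
    case (Suc n)
    have "of_nat (Suc n) * p = of_nat n * p + p" by (simp add: distrib_right add.commute)
    then show ?case
      using m.hom_add[OF carrier carrier] Suc
      by (simp only: U.add.nat_pow_Suc tensor_algebra_simps(4)[symmetric])
  qed
qed

theorem proposition3p1:
  fixes scale :: "'k::comm_ring_1 \<Rightarrow> 'g::ab_group_add \<Rightarrow> 'g"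
    and bracket :: "'g \<Rightarrow> 'g \<Rightarrow> 'g"
    and n :: nat
    and W :: "('g list \<Rightarrow>\<^sub>0 'k) set set"
    and P :: "('g list \<Rightarrow>\<^sub>0 'k) set"
    and \<Lambda> :: "'i set"
    and a :: "nat \<Rightarrow> 'i \<Rightarrow> 'g"
  assumes "contains_rat TYPE('k)"
    and "lie_algebra scale bracket"
    and "n \<ge> 1"
    and "submodule W ring_of_type_algebra (tensor_algebra scale)"
    and "W \<subseteq> tensor_power scale n"
    and "\<And>\<sigma> A. \<sigma> permutes {..<n} \<Longrightarrow> A \<in> W \<Longrightarrow> tensor_permute scale n \<sigma> A \<in> W"
    and "inj_on (enveloping_map scale bracket) W"
    and "finite \<Lambda>"
    and "P = (\<Oplus>\<^bsub>tensor_algebra scale\<^esub>l\<in>\<Lambda>. pure_tensor scale (map (\<lambda>i. a i l) [1..<n + 1]))"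
    and "P \<in> W"
    and "enveloping_map scale bracket P \<in> range (enveloping_incl scale bracket)"
  shows "[n] \<cdot>\<^bsub>enveloping_algebra scale bracket\<^esub> enveloping_map scale bracket P
    = enveloping_incl scale bracket
        (\<Sum>l\<in>\<Lambda>. left_bracket bracket (map (\<lambda>i. a i l) [1..<n + 1]))"
proof -
  define w where "w l = map (\<lambda>i. a i l) [1..<n + 1]" for l
  define p where "p = (\<Sum>l\<in>\<Lambda>. Poly_Mapping.single (w l) (1::'k))"
  have len: "length (w l) = n" for l by (simp add: w_def)
  have P: "P = tensor_class scale p"
    unfolding assms(9) pure_tensor_def finsum_tensor_class[OF assms(8)] by (simp only: p_def w_def)
  interpret W: submodule W ring_of_type_algebra "tensor_algebra scale" by (rule assms(4))
  obtain x where "enveloping_map scale bracket P = enveloping_incl scale bracket x"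
    using assms(11) by blast
  then have x: "p - Poly_Mapping.single [x] 1 \<in> enveloping_null scale bracket"
    unfolding P enveloping_incl_def pure_tensor_def enveloping_map_eq_iff .
  have eigen: "linear_extension (adams k) p - of_nat k * p \<in> tensor_null scale" for k
  proof -
    have "linear_extension (adams k) (p - Poly_Mapping.single [x] 1) -
        of_nat k * (p - Poly_Mapping.single [x] 1) \<in> enveloping_null scale bracket"
      by (intro enveloping_null_closed(3,4) adams_enveloping_null x)
    then have "linear_extension (adams k) p - of_nat k * p \<in> enveloping_null scale bracket"
      by (simp add: linear_extension_diff free_scale_1 adams_singleton right_diff_distrib)
    then have "enveloping_map scale bracket (tensor_class scale (linear_extension (adams k) p)) =
        enveloping_map scale bracket (tensor_class scale (of_nat k * p))"
      by (simp only: enveloping_map_eq_iff)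
    moreover have "tensor_class scale (linear_extension (adams k) p) \<in> W"
      by (rule adams_class_in_permutation_closed[OF assms(4,6) len p_def assms(10)[unfolded P]])
    moreover have "tensor_class scale (of_nat k * p) \<in> W"
      using W.smult_closed[of "of_nat k" "tensor_class scale p"] assms(10)
      by (simp only: type_ring_simps UNIV_I smult_tensor_class free_scale_of_nat P simp_thms)
    ultimately have "tensor_class scale (linear_extension (adams k) p) = tensor_class scale (of_nat k * p)"
      by (rule inj_onD[OF assms(7)])
    then show ?thesis by (simp only: tensor_class_eq_iff)
  qed
  have "of_nat n * p - linear_extension dynkin p \<in> enveloping_null scale bracket"
    using dynkin_of_adams_eigenvector[OF assms(1,3) p_def len eigen] tensor_null_subset_enveloping_null
    by blast
  moreover have "(\<Sum>l\<in>\<Lambda>. dynkin (w l) - Poly_Mapping.single [left_bracket bracket (w l)] 1)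
      \<in> enveloping_null scale bracket"
  proof (rule enveloping_null_sum)
    fix l
    have "w l \<noteq> []" using len[of l] assms(3) by auto
    then show "dynkin (w l) - Poly_Mapping.single [left_bracket bracket (w l)] 1
        \<in> enveloping_null scale bracket"
      by (rule dynkin_left_bracket)
  qed
  moreover have "(\<Sum>l\<in>\<Lambda>. Poly_Mapping.single [left_bracket bracket (w l)] 1) -
      Poly_Mapping.single [\<Sum>l\<in>\<Lambda>. left_bracket bracket (w l)] 1 \<in> enveloping_null scale bracket"
    by (rule subsetD[OF tensor_null_subset_enveloping_null single_sum_letter])
  ultimately have "(of_nat n * p - linear_extension dynkin p) +
      (\<Sum>l\<in>\<Lambda>. dynkin (w l) - Poly_Mapping.single [left_bracket bracket (w l)] 1) +
      ((\<Sum>l\<in>\<Lambda>. Poly_Mapping.single [left_bracket bracket (w l)] 1) -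
      Poly_Mapping.single [\<Sum>l\<in>\<Lambda>. left_bracket bracket (w l)] 1) \<in> enveloping_null scale bracket"
    by (intro enveloping_null_closed(2))
  then have "of_nat n * p - Poly_Mapping.single [\<Sum>l\<in>\<Lambda>. left_bracket bracket (w l)] 1
      \<in> enveloping_null scale bracket"
    by (simp add: p_def linear_extension_sum free_scale_1 sum_subtractf)
  then show ?thesis
    unfolding P add_pow_enveloping_map enveloping_incl_def pure_tensor_def enveloping_map_eq_iff
    by (simp only: w_def)
qed

end
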